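(* Let $1\le p<2$ and let $r$ be a real number with $r>p$. Let $p'$ be the exponent conjugate to $p$ ($p'=\infty$ if $p=1$). Then there exists a constant $C_{p,r}<\infty$, depending only on $p$ and $r$, such that for every $F\in\ell^p(\mathbb{Z},\mathcal{D})$, $$\|\mathcal{V}_r(\gamma[F])\|_{L^{p'}(\mathbb{S})}+\|\mathcal{V}_r(\gamma[F])\|^{1/r}_{L^{p'/r}(\mathbb{T}\setminus\mathbb{S})}\le C_{p,r}\,\Big\|\log\Big(\frac{1+|F_n|}{1-|F_n|}\Big)\Big\|_{\ell^p(\mathbb{Z})},$$ where $\mathbb{S}=\mathbb{S}_{p,r}[F]=\{z\in\mathbb{T}:\mathcal{V}_s(\gamma[F])(z)\le 1\}$, with $s=r$ if $p<r<2$, and $s=\frac{p+2}{2}$ if $r\ge 2$.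
   Context: $\mathcal{D}$ is the open unit disc in $\mathbb{C}$ and $\mathbb{T}$ is the unit circle, with Lebesgue measure normalized to total mass 1. $\ell^p(\mathbb{Z},\mathcal{D})$ is the set of sequences $F=(F_n)_{n\in\mathbb{Z}}$ in $\ell^p(\mathbb{Z})$ with $F_n\in\mathcal{D}$ for all $n$. For $0<q<\infty$ and measurable $E\subset\mathbb{T}$, $\|h\|_{L^q(E)}=(\int_E|h|^q)^{1/q}$ (only a quasi-norm if $q<1$), and $\|h\|_{L^\infty(E)}$ is the essential supremum; $\infty/r=\infty$. $\mathrm{SU}(1,1)$ is the group of matrices $\begin{pmatrix}a&b\\ \overline{b}&\overline{a}\end{pmatrix}$ with $a,b\in\mathbb{C}$, $|a|^2-|b|^2=1$. It carries the distance $d(X,Y)=\log(1+\|X^{-1}Y-I\|_{\mathrm{op}})$, where $I$ is the $2\times2$ identity matrix and $\|\cdot\|_{\mathrm{op}}$ is the operator norm on the Hilbert space $\mathbb{C}^2$. For a $\mathcal{D}$-valued sequence $F$, $n\in\mathbb{Z}$ and $z\in\mathbb{T}$, the transfer matrix is $$T_n(z)=(1-|F_n|^2)^{-1/2}\begin{pmatrix}1&F_nz^n\\ \overline{F_n}z^{-n}&1\end{pmatrix}\in\mathrm{SU}(1,1).$$ The truncated nonlinear Fourier transform is $\gamma_N(z)=\gamma[F](N;z)=\prod_{n=-\infty}^N T_n(z)$ for $N\in\mathbb{Z}$, the product being ordered with $n$ increasing from left to right. Thus for $M<N$, $\gamma_M(z)^{-1}\gamma_N(z)=T_{M+1}(z)T_{M+2}(z)\cdots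 T_N(z)$; for general (not finitely supported) $F$, $d(\gamma_M(z),\gamma_N(z))$ is understood through this finite product, i.e. as $\log(1+\|T_{M+1}(z)\cdots T_N(z)-I\|_{\mathrm{op}})$. For $1\le r<\infty$, the $r$-variation is $$\mathcal{V}_r(\gamma[F])(z)=\sup_{K}\sup_{N_0<\dots<N_K}\Big(\sum_{j=0}^{K-1}d(\gamma_{N_j}(z),\gamma_{N_{j+1}}(z))^r\Big)^{1/r},$$ the suprema being over all integers $K\ge1$ and all strictly increasing finite sequences of integers $N_0<\dots<N_K$. *)

theory Defs
  imports "HOL-Probability.Essential_Supremum"
begin

definition SU11 :: "(complex^2^2) set" where
  "SU11 = {vector [vector [a, b], vector [cnj b, cnj a]] | a b.
             (cmod a)\<^sup>2 - (cmod b)\<^sup>2 = 1}"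

text \<open>The norm on \<^typ>\<open>complex^2\<close> is the Hilbert space norm, so \<^const>\<open>onorm\<close> is the
  operator norm on the Hilbert space of complex pairs.\<close>

definition su_dist :: "complex^2^2 \<Rightarrow> complex^2^2 \<Rightarrow> real" where
  "su_dist X Y = ln (1 + onorm ((*v) (matrix_inv X ** Y - mat 1)))"

definition transfer :: "(int \<Rightarrow> complex) \<Rightarrow> int \<Rightarrow> complex \<Rightarrow> complex^2^2" where
  "transfer F n z = (1 - (cmod (F n))\<^sup>2) powr (-1/2) *\<^sub>R
     vector [vector [1, F n * z powi n],
             vector [cnj (F n) * z powi (-n), 1]]"

text \<open>The ordered product of the transfer matrices with indices \<open>M + 1, \<dots>, N\<close>, the index
  increasing from left to right.\<close>

definition transfer_prod :: "(int \<Rightarrow> complex) \<Rightarrow> int \<Rightarrow> int \<Rightarrow> complex \<Rightarrow> complex^2^2" where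
  "transfer_prod F M N z = foldr (**) (map (\<lambda>n. transfer F n z) [M+1..N]) (mat 1)"

text \<open>The distance between the truncated nonlinear Fourier transforms at \<open>M < N\<close>. For a general
  sequence the infinite product defining the truncations need not converge, so their distance is
  expressed through the finite product that the quotient formally equals. The lemma
  \<open>nlft_dist_truncated\<close> below confirms the agreement for products starting at a finite index.\<close>

definition nlft_dist :: "(int \<Rightarrow> complex) \<Rightarrow> int \<Rightarrow> int \<Rightarrow> complex \<Rightarrow> real" where
  "nlft_dist F M N z = su_dist (mat 1) (transfer_prod F M N z)"

text \<open>Real powers of extended nonnegative reals, only meant for exponents \<open>q > 0\<close>.\<close>

definition ennreal_rpow :: "ennreal \<Rightarrow> real \<Rightarrow> ennreal" where
  "ennreal_rpow x q = (if x = \<infinity> then \<infinity> else ennreal (enn2real x powr q))"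

definition nlft_variation :: "real \<Rightarrow> (int \<Rightarrow> complex) \<Rightarrow> complex \<Rightarrow> ennreal" where
  "nlft_variation r F z =
     (SUP K\<in>{1::nat..}. SUP N\<in>{N :: nat \<Rightarrow> int. strict_mono_on {0..K} N}.
        ennreal ((\<Sum>j<K. nlft_dist F (N j) (N (Suc j)) z powr r) powr (1/r)))"

definition unit_circle :: "complex set" where
  "unit_circle = sphere 0 1"

text \<open>Normalized arc length, as a Borel measure on the plane carried by the unit circle.\<close>

definition circle_measure :: "complex measure" where
  "circle_measure = distr (restrict_space lborel {0..1}) borel (\<lambda>t. cis (2 * pi * t))"

definition Lq_norm :: "'a measure \<Rightarrow> ennreal \<Rightarrow> 'a set \<Rightarrow> ('a \<Rightarrow> ennreal) \<Rightarrow> ennreal" where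
  "Lq_norm M q E h =
     (if q = \<infinity> then esssup M (\<lambda>x. h x * indicator E x)
      else ennreal_rpow (\<integral>\<^sup>+x\<in>E. ennreal_rpow (h x) (enn2real q) \<partial>M) (1 / enn2real q))"

definition ellp_disc :: "real \<Rightarrow> (int \<Rightarrow> complex) set" where
  "ellp_disc p = {F. (\<forall>n. F n \<in> ball 0 1) \<and> (\<lambda>n. cmod (F n) powr p) summable_on UNIV}"

definition conj_exponent :: "real \<Rightarrow> ennreal" where
  "conj_exponent p = (if p = 1 then \<infinity> else ennreal (p / (p - 1)))"

definition threshold_exponent :: "real \<Rightarrow> real \<Rightarrow> real" where
  "threshold_exponent p r = (if r < 2 then r else (p + 2) / 2)"

definition small_variation_set :: "real \<Rightarrow> real \<Rightarrow> (int \<Rightarrow> complex) \<Rightarrow> complex set" where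
  "small_variation_set p r F =
     {z \<in> unit_circle. nlft_variation (threshold_exponent p r) F z \<le> 1}"


lemma transfer_in_SU11:
  assumes "cmod (F n) < 1" "cmod z = 1"
  shows "transfer F n z \<in> SU11"
proof -
  define c where "c = (1 - (cmod (F n))\<^sup>2) powr (-1/2)"
  define a where "a = complex_of_real c"
  define b where "b = complex_of_real c * (F n * z powi n)"
  have pos: "1 - (cmod (F n))\<^sup>2 > 0"
    using assms(1) by (simp add: power_less_one_iff)
  have "c\<^sup>2 = (1 - (cmod (F n))\<^sup>2) powr (-1)"
    by (simp add: c_def power2_eq_square flip: powr_add)
  then have c2: "c\<^sup>2 * (1 - (cmod (F n))\<^sup>2) = 1"
    using pos by (simp add: powr_minus_divide)
  have "inverse z = cnj z"
    using assms(2) by (metis complex_norm_square divide_conv_cnj inverse_eq_divide mult_1)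
  then have zc: "z powi (-n) = cnj (z powi n)"
    by (simp add: power_int_minus power_int_def flip: power_inverse)
  have "(cmod a)\<^sup>2 - (cmod b)\<^sup>2 = 1"
    using c2 assms(2)
    by (simp add: a_def b_def norm_mult norm_power_int power_mult_distrib algebra_simps)
  moreover have "transfer F n z = vector [vector [a, b], vector [cnj b, cnj a]]"
    unfolding transfer_def zc c_def[symmetric]
    by (simp add: vec_eq_iff forall_2 a_def b_def scaleR_conv_of_real[where ?'a = complex])
  ultimately show ?thesis
    unfolding SU11_def by blast
qed

lemma invertible_SU11:
  assumes "X \<in> SU11"
  shows "invertible X"
proof -
  obtain a b where X: "X = vector [vector [a, b], vector [cnj b, cnj a]]"
    and ab: "(cmod a)\<^sup>2 - (cmod b)\<^sup>2 = 1"
    using assms by (auto simp: SU11_def)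
  have "det X = of_real ((cmod a)\<^sup>2 - (cmod b)\<^sup>2)"
    by (simp add: X det_2 flip: complex_norm_square)
  then show ?thesis
    using ab by (simp add: invertible_det_nz)
qed

lemma transfer_prod_append:
  assumes "L \<le> M" "M \<le> N"
  shows "transfer_prod F L N z = transfer_prod F L M z ** transfer_prod F M N z"
proof -
  have foldr_append: "foldr (**) xs A = foldr (**) xs (mat 1) ** A" for xs and A :: "complex^2^2"
    by (induction xs) (simp_all add: matrix_mul_assoc flip: matrix_mul_assoc)
  have "[L+1..N] = [L+1..M] @ [M+1..N]"
    using assms by (cases "L = M") (auto simp: upto_split2)
  then show ?thesis
    unfolding transfer_prod_def by (simp add: foldr_append[symmetric])
qed

lemma invertible_transfer_prod:
  assumes "\<And>n. cmod (F n) < 1" "cmod z = 1"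
  shows "invertible (transfer_prod F M N z)"
proof -
  have "invertible (foldr (**) (map (\<lambda>n. transfer F n z) ns) (mat 1))" for ns
  proof (induction ns)
    case Nil
    then show ?case by (simp add: invertible_det_nz)
  next
    case (Cons n ns)
    then show ?case
      using invertible_SU11[OF transfer_in_SU11[of F n z]] assms by (simp add: invertible_mult)
  qed
  then show ?thesis by (simp add: transfer_prod_def)
qed

lemma matrix_inv_left_eq:
  fixes A :: "complex^2^2"
  assumes "invertible A"
  shows "matrix_inv A ** A = mat 1"
  using someI_ex[of "\<lambda>B. A ** B = mat 1 \<and> B ** A = mat 1"] assms
  by (simp add: invertible_def matrix_inv_def)

lemma matrix_inv_mat1: "matrix_inv (mat 1) = (mat 1 :: complex^2^2)"
  using matrix_inv_left_eq[of "mat 1"] by (simp add: invertible_det_nz)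

lemma nlft_dist_eq:
  "nlft_dist F M N z = ln (1 + onorm ((*v) (transfer_prod F M N z - mat 1)))"
  by (simp add: nlft_dist_def su_dist_def matrix_inv_mat1)

lemma nlft_dist_truncated:
  assumes "\<And>n. cmod (F n) < 1" "cmod z = 1" "L \<le> M" "M \<le> N"
  shows "nlft_dist F M N z = su_dist (transfer_prod F L M z) (transfer_prod F L N z)"
proof -
  have "matrix_inv (transfer_prod F L M z) ** transfer_prod F L M z = mat 1"
    using invertible_transfer_prod[OF assms(1,2)] by (rule matrix_inv_left_eq)
  then show ?thesis
    using assms(3,4)
    by (simp add: nlft_dist_eq su_dist_def transfer_prod_append[of L M N] matrix_mul_assoc)
qed

lemma circle_measure_carrier:
  "emeasure circle_measure unit_circle = 1" "emeasure circle_measure UNIV = 1"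
proof -
  have [measurable]: "(\<lambda>t. cis (2 * pi * t)) \<in> borel_measurable (restrict_space lborel {0..1})"
    by (intro measurable_restrict_space1) 
       (simp, intro borel_measurable_continuous_onI continuous_intros)
  show "emeasure circle_measure unit_circle = 1"
    unfolding circle_measure_def unit_circle_def
    by (subst emeasure_distr) (auto simp: vimage_def emeasure_restrict_space space_restrict_space)
  show "emeasure circle_measure UNIV = 1"
    unfolding circle_measure_def
    by (subst emeasure_distr) (auto simp: emeasure_restrict_space space_restrict_space)
qed

end

theory Submission
  imports Defs
begin

text \<open>The Lie group product is an ordered exponential. With
\<open>g n = (1/2) * ln ((1 + \<bar>F n\<bar>) / (1 - \<bar>F n\<bar>)) * sgn (F n)\<close> the transfer matrix is the exponential of the
Hermitian off-diagonal matrix with upper right entry \<open>g n * z\<^sup>n\<close>, so the partial products \<open>\<gamma>\<close> solve a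
multiplicative equation driven by the path of partial sums of \<open>\<Sum>n. g n * z\<^sup>n\<close>. For an exponent
\<open>\<rho> < 2\<close> such an equation is governed by the \<open>\<rho>\<close>-variation of the driving path (Young integration, in the form
given to it by Lyons). The theorem is then the variational Hausdorff--Young inequality for the
linear sums, transported to the group pointwise in \<open>z\<close>.

Both steps are phrased in terms of a \<^emph>\<open>control\<close>: a nonnegative superadditive function \<open>w M N\<close> of
intervals with \<open>\<bar>\<Sum>n\<in>{M+1..N}. g n * z\<^sup>n\<bar> powr \<rho> \<le> w M N\<close>. It plays the role of the \<open>\<rho>\<close>-th power of the
\<open>\<rho>\<close>-variation on the interval.

\<^item> Pointwise step (\<open>small_product_estimate\<close>, \<open>nlft_dist_le_control\<close>). If \<open>y = w M N powr (1/\<rho>)\<close> is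
small, the product over \<open>(M, N]\<close> differs from \<open>1 + \<close> the off-diagonal matrix of the linear sum by
\<open>O(y\<^sup>2)\<close>. This is an induction on the length of the interval: cut it at a single index so that both remaining pieces have
at most half the control; each of them has an error of at most \<open>2 powr (-2/\<rho>)\<close> times the allowed one, and
\<open>2 * 2 powr (-2/\<rho>) < 1\<close> leaves room for the cross terms. Large intervals are cut greedily into small ones and single
steps. The conclusion is that the \<open>\<rho>\<close>-variation of \<open>\<gamma>\<close> is at most \<open>C * (v + v powr \<rho>)\<close>,
where \<open>v powr \<rho>\<close> is the control of the whole range.

\<^item> Linear step (\<open>hausdorff_young\<close>, \<open>tree_control_exists\<close>). A control is built by the method of Christ and
Kiselev: halve the \<open>\<ell>\<^sup>p\<close>-mass recursively and sum the \<open>\<rho>\<close>-th powers of the sums over the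
intervals that arise, with weights that grow geometrically but slowly with the depth. By the
Hausdorff--Young inequality the \<open>2\<^sup>j\<close> intervals of depth \<open>j\<close> contribute a multiple of
\<open>2 powr (j * (1 - \<rho>/p))\<close>, and \<open>\<rho> > p\<close> makes the sum over \<open>j\<close> converge. The Hausdorff--Young inequality, with some constant, comes from splitting the sequence at
heights adapted to the dyadic levels of its transform (Marcinkiewicz interpolation).

Both are applied with \<open>\<rho> = threshold_exponent p r\<close>, which lies in \<open>(p, 2)\<close> and is at most \<open>r\<close>. Where
the \<open>\<rho>\<close>-variation of \<open>\<gamma>\<close> is at most \<open>1\<close> it is bounded by a multiple of \<open>v\<close>; elsewhere
\<open>v\<close> is bounded below, and the variation is at most a multiple of \<open>v powr r\<close> (\<open>variation_dichotomy\<close>); this is the origin of the two norms in the theorem.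
Everything is done on finite windows of indices and passed to the limit by monotone convergence. For \<open>p = 1\<close> a power of the mass is a
control, uniformly in \<open>z\<close>, and takes the place of the linear step.\<close>

section \<open>Inequalities for powers\<close>

lemma half_powr: "(x / 2) powr a = 2 powr (-a) * x powr a" if "0 \<le> x" for x a :: real
  using that by (simp add: powr_divide powr_minus_divide)

lemma powr_add_le:
  fixes a b :: real
  assumes "0 \<le> a" "0 \<le> b" "0 \<le> s"
  shows "(a + b) powr s \<le> 2 powr s * (a powr s + b powr s)"
proof -
  have "(a + b) powr s \<le> (2 * max a b) powr s" using assms by (intro powr_mono2) auto
  also have "\<dots> = 2 powr s * max a b powr s" using assms by (simp add: powr_mult)
  also have "max a b powr s \<le> a powr s + b powr s" by (simp add: max_def)
  finally show ?thesis by simp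
qed

lemma powr_add3_le:
  fixes a b c s :: real
  assumes "0 \<le> a" "0 \<le> b" "0 \<le> c" "0 \<le> s"
  shows "(a + b + c) powr s \<le> 3 powr s * (a powr s + b powr s + c powr s)"
proof -
  define m where "m = max (max a b) c"
  have "(a + b + c) powr s \<le> (3 * m) powr s"
    using assms unfolding m_def by (intro powr_mono2) auto
  also have "\<dots> = 3 powr s * m powr s" using assms by (simp add: powr_mult m_def)
  also have "m powr s \<le> a powr s + b powr s + c powr s"
    unfolding m_def by (auto simp: max_def)
  finally show ?thesis by simp
qed

lemma powr_superadd:
  fixes a b :: real
  assumes "0 \<le> a" "0 \<le> b" "1 \<le> s"
  shows "a powr s + b powr s \<le> (a + b) powr s"
proof -
  have 1: "x powr s = x powr (s - 1) * x" if "0 \<le> x" for x :: real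
    using that powr_add[of x "s - 1" 1] by (cases "x = 0") auto
  have "a powr s + b powr s \<le> (a + b) powr (s - 1) * a + (a + b) powr (s - 1) * b"
    using assms unfolding 1[OF assms(1)] 1[OF assms(2)]
    by (intro add_mono mult_right_mono powr_mono2) auto
  then show ?thesis using 1[of "a + b"] assms by (simp add: distrib_left)
qed

lemma sum_powr_le:
  fixes a :: "'a \<Rightarrow> real"
  assumes "finite S" "\<And>i. i \<in> S \<Longrightarrow> 0 \<le> a i" "1 \<le> t"
  shows "(\<Sum>i\<in>S. a i powr t) \<le> (\<Sum>i\<in>S. a i) powr t"
  using assms
proof (induction S rule: finite_induct)
  case (insert x S)
  then have "(\<Sum>i\<in>insert x S. a i powr t) \<le> a x powr t + (\<Sum>i\<in>S. a i) powr t" by simp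
  also have "\<dots> \<le> (a x + (\<Sum>i\<in>S. a i)) powr t"
    using insert.prems by (intro powr_superadd sum_nonneg) auto
  finally show ?case using insert by simp
qed simp

text \<open>The factor in front of the main term can be brought arbitrarily close to \<open>1\<close>. In the recursive
construction of a control this factor is paid once for each level of the recursion.\<close>

lemma powr_add_le_eps:
  fixes A s :: real
  assumes "A > 1" "s > 0"
  obtains C where "0 \<le> C" "\<And>x y. 0 \<le> x \<Longrightarrow> 0 \<le> y \<Longrightarrow> (x + y) powr s \<le> A * x powr s + C * y powr s"
proof -
  define \<eta> where "\<eta> = A powr (1 / s) - 1"
  have "A powr 0 < A powr (1 / s)" using assms by (intro powr_less_mono) auto
  then have \<eta>: "\<eta> > 0" "(1 + \<eta>) powr s = A" using assms by (auto simp: \<eta>_def powr_powr)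
  show thesis
  proof (rule that[of "(1 / \<eta> + 1) powr s"])
    fix x y :: real assume xy: "0 \<le> x" "0 \<le> y"
    show "(x + y) powr s \<le> A * x powr s + (1 / \<eta> + 1) powr s * y powr s"
    proof (cases "y \<le> \<eta> * x")
      case True
      then have "(x + y) powr s \<le> ((1 + \<eta>) * x) powr s"
        using xy assms by (intro powr_mono2) (auto simp: algebra_simps)
      also have "\<dots> = A * x powr s" using xy \<eta> by (simp add: powr_mult)
      finally show ?thesis by (simp add: add_increasing2)
    next
      case False
      then have "(x + y) powr s \<le> ((1 / \<eta> + 1) * y) powr s"
        using xy assms \<eta> by (intro powr_mono2) (auto simp: field_simps)
      also have "\<dots> = (1 / \<eta> + 1) powr s * y powr s" using xy \<eta> by (simp add: powr_mult)
      finally show ?thesis using assms by (simp add: add_increasing)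
    qed
  qed simp
qed

text \<open>The sharp constant matters: two halves are merged at every level of a recursion, and
\<open>2 powr (s - 1)\<close> is exactly balanced against the gain from halving the mass.\<close>

lemma powr_add_le_convex:
  fixes a b s :: real
  assumes "0 \<le> a" "0 \<le> b" "1 \<le> s"
  shows "(a + b) powr s \<le> 2 powr (s - 1) * (a powr s + b powr s)"
proof (cases "a = 0 \<or> b = 0")
  case True
  have "1 \<le> 2 powr (s - 1)" using assms by (simp add: ge_one_powr_ge_zero)
  then have "x powr s \<le> 2 powr (s - 1) * x powr s" for x :: real
    by (simp add: mult_le_cancel_right1)
  then show ?thesis using True assms by auto
next
  case False
  then have ab: "a > 0" "b > 0" using assms by auto
  have "((1/2) *\<^sub>R a + (1/2) *\<^sub>R b) powr s \<le> (1/2) * a powr s + (1/2) * b powr s"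
    using convex_onD[OF powr_convex[OF assms(3)], of "1/2" a b] ab by simp
  then have "((a + b) / 2) powr s \<le> (a powr s + b powr s) / 2" by (simp add: field_simps)
  moreover have "((a + b) / 2) powr s = (a + b) powr s / 2 powr s"
    using ab by (simp add: powr_divide)
  ultimately show ?thesis by (simp add: powr_diff field_simps)
qed

lemma geometric_sum_le_last:
  fixes b T :: real
  assumes "1 < b" "finite X" "\<And>k. k \<in> X \<Longrightarrow> b ^ k \<le> T" "0 \<le> T"
  shows "(\<Sum>k\<in>X. b ^ k) \<le> T * (b / (b - 1))"
proof (cases "X = {}")
  case True
  then show ?thesis using assms by simp
next
  case False
  define m where "m = Max X"
  have "(\<Sum>k\<in>X. b ^ k) \<le> (\<Sum>k<Suc m. b ^ k)"
    using assms by (intro sum_mono2) (auto simp: m_def less_Suc_eq_le)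
  also have "\<dots> = (b ^ Suc m - 1) / (b - 1)" using assms by (subst geometric_sum) auto
  also have "\<dots> \<le> (b ^ m * b) / (b - 1)" using assms by (intro divide_right_mono) auto
  also have "\<dots> \<le> (T * b) / (b - 1)"
    using assms False by (intro divide_right_mono mult_right_mono) (auto simp: m_def)
  finally show ?thesis by simp
qed

section \<open>Superadditive functions of intervals\<close>

text \<open>The model case is the \<open>\<rho>\<close>-th power of the \<open>\<rho>\<close>-variation of a path on the interval from \<open>M\<close> to \<open>N\<close>.\<close>

definition control :: "(int \<Rightarrow> int \<Rightarrow> real) \<Rightarrow> int \<Rightarrow> int \<Rightarrow> bool" where
  "control w s t \<longleftrightarrow> (\<forall>M N. s \<le> M \<longrightarrow> M \<le> N \<longrightarrow> N \<le> t \<longrightarrow> 0 \<le> w M N) \<and>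
     (\<forall>M N L. s \<le> M \<longrightarrow> M \<le> N \<longrightarrow> N \<le> L \<longrightarrow> L \<le> t \<longrightarrow> w M N + w N L \<le> w M L)"

lemma control_nonneg: "control w s t \<Longrightarrow> s \<le> M \<Longrightarrow> M \<le> N \<Longrightarrow> N \<le> t \<Longrightarrow> 0 \<le> w M N"
  and control_superadd: "control w s t \<Longrightarrow> s \<le> M \<Longrightarrow> M \<le> N \<Longrightarrow> N \<le> L \<Longrightarrow> L \<le> t
    \<Longrightarrow> w M N + w N L \<le> w M L"
  unfolding control_def by blast+

lemma control_subinterval: "control w s t \<Longrightarrow> s \<le> s' \<Longrightarrow> t' \<le> t \<Longrightarrow> control w s' t'"
  unfolding control_def by (meson order_trans)

lemma control_diag: "control w s t \<Longrightarrow> s \<le> M \<Longrightarrow> M \<le> t \<Longrightarrow> w M M = 0"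
  using control_nonneg[of w s t M M] control_superadd[of w s t M M M] by simp

lemma control_mono:
  assumes "control w s t" "s \<le> M'" "M' \<le> M" "M \<le> N" "N \<le> N'" "N' \<le> t"
  shows "w M N \<le> w M' N'"
proof -
  have "w M' M + w M N \<le> w M' N" "w M' N + w N N' \<le> w M' N'"
    using assms by (auto intro!: control_superadd[OF assms(1)])
  moreover have "0 \<le> w M' M" "0 \<le> w N N'"
    using assms by (auto intro!: control_nonneg[OF assms(1)])
  ultimately show ?thesis by linarith
qed

lemma control_sum:
  assumes w: "control w s t" and "\<And>j. j < K \<Longrightarrow> N j \<le> N (Suc j)"
    and "s \<le> N 0" "N K \<le> t"
  shows "N 0 \<le> N K \<and> (\<Sum>j<K. w (N j) (N (Suc j))) \<le> w (N 0) (N K)"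
  using assms(2,4)
proof (induction K)
  case 0
  then show ?case using control_diag[OF w, of "N 0"] \<open>s \<le> N 0\<close> by simp
next
  case (Suc K)
  have K: "N K \<le> N (Suc K)" using Suc.prems(1)[of K] by simp
  have IH: "N 0 \<le> N K" "(\<Sum>j<K. w (N j) (N (Suc j))) \<le> w (N 0) (N K)"
    using Suc.IH Suc.prems K by auto
  have "w (N 0) (N K) + w (N K) (N (Suc K)) \<le> w (N 0) (N (Suc K))"
    using IH K Suc.prems(2) \<open>s \<le> N 0\<close> by (intro control_superadd[OF w])
  then show ?case using IH K by simp
qed

text \<open>The largest \<open>u\<close> for which the left piece carries at most half of the total works: prolonging the left piece by one
index makes it exceed one half, so superadditivity leaves less than one half for what follows. The single
index \<open>u + 1\<close> is left out of both pieces since it may carry nearly everything.\<close>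

lemma control_median:
  assumes w: "control w s t" and "s < t"
  obtains u where "s \<le> u" "u < t" "w s u \<le> w s t / 2" "w (u + 1) t \<le> w s t / 2"
proof -
  define U where "U = {u \<in> {s..<t}. w s u \<le> w s t / 2}"
  have "0 \<le> w s t" "w s s = 0"
    using w \<open>s < t\<close> control_nonneg[OF w, of s t] control_diag[OF w, of s] by auto
  then have "s \<in> U" using \<open>s < t\<close> by (simp add: U_def)
  define u where "u = Max U"
  have fin: "finite U" by (rule finite_subset[of _ "{s..<t}"]) (auto simp: U_def)
  have u: "u \<in> U" unfolding u_def using fin \<open>s \<in> U\<close> by (intro Max_in) auto
  have "w (u + 1) t \<le> w s t / 2"
  proof (cases "u + 1 = t")
    case True
    then show ?thesis
      using control_diag[OF w, of t] \<open>s < t\<close> \<open>0 \<le> w s t\<close> by simp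
  next
    case False
    then have "u + 1 \<notin> U" using Max_ge[OF fin, of "u + 1"] by (auto simp: u_def)
    then have "w s (u + 1) > w s t / 2" using u False by (auto simp: U_def)
    moreover have "w s (u + 1) + w (u + 1) t \<le> w s t"
      using u False by (intro control_superadd[OF w]) (auto simp: U_def)
    ultimately show ?thesis by linarith
  qed
  then show ?thesis using that u by (auto simp: U_def)
qed

lemma control_powr:
  assumes "control w s t" "1 \<le> a"
  shows "control (\<lambda>M N. w M N powr a) s t"
  unfolding control_def
proof (intro conjI allI impI)
  fix M N L assume *: "s \<le> M" "M \<le> N" "N \<le> L" "L \<le> t"
  have "w M N powr a + w N L powr a \<le> (w M N + w N L) powr a"
    using * assms by (intro powr_superadd control_nonneg[OF assms(1)]) auto
  also have "\<dots> \<le> w M L powr a"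
    using * assms by (intro powr_mono2 control_superadd[OF assms(1)] add_nonneg_nonneg control_nonneg[OF assms(1)]) auto
  finally show "w M N powr a + w N L powr a \<le> w M L powr a" .
qed simp

lemma control_add:
  "control v s t \<Longrightarrow> control w s t \<Longrightarrow> control (\<lambda>M N. v M N + w M N) s t"
  unfolding control_def by (auto intro!: add_nonneg_nonneg) (smt (verit) order_trans)

lemma control_scale:
  "control w s t \<Longrightarrow> 0 \<le> c \<Longrightarrow> control (\<lambda>M N. c * w M N) s t"
  unfolding control_def by (auto simp: mult_left_mono simp flip: distrib_left)

lemma control_indicator:
  "a < b \<or> v = 0 \<Longrightarrow> 0 \<le> v \<Longrightarrow> control (\<lambda>M N. if M \<le> a \<and> b \<le> N then v else 0) s t"
  unfolding control_def by auto

lemma control_restrict_left: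
  "control w s u \<Longrightarrow> s \<le> u \<Longrightarrow> control (\<lambda>M N. w (min M u) (min N u)) s t"
  unfolding control_def by (auto intro!: min.mono)

lemma control_restrict_right:
  "control w u t \<Longrightarrow> u \<le> t \<Longrightarrow> control (\<lambda>M N. w (max M u) (max N u)) s t"
  unfolding control_def by (auto intro!: max.mono)

definition mass :: "real \<Rightarrow> (int \<Rightarrow> complex) \<Rightarrow> int \<Rightarrow> int \<Rightarrow> real" where
  "mass p f M N = (\<Sum>n\<in>{M+1..N}. cmod (f n) powr p)"

lemma mass_nonneg: "0 \<le> mass p f M N"
  by (simp add: mass_def sum_nonneg)

lemma control_mass: "control (mass p f) s t"
proof -
  have "mass p f M N + mass p f N L = mass p f M L" if "M \<le> N" "N \<le> L" for M N L
  proof -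
    have "{M+1..L} = {M+1..N} \<union> {N+1..L}" using that by auto
    then show ?thesis unfolding mass_def by (simp add: sum.union_disjoint)
  qed
  then show ?thesis by (auto simp: control_def mass_nonneg)
qed

definition trig_sum :: "(int \<Rightarrow> complex) \<Rightarrow> int \<Rightarrow> int \<Rightarrow> complex \<Rightarrow> complex" where
  "trig_sum f M N z = (\<Sum>n\<in>{M+1..N}. f n * z powi n)"

lemma trig_sum_append:
  assumes "L \<le> M" "M \<le> N"
  shows "trig_sum f L N z = trig_sum f L M z + trig_sum f M N z"
proof -
  have "{L+1..N} = {L+1..M} \<union> {M+1..N}" using assms by auto
  then show ?thesis unfolding trig_sum_def by (simp add: sum.union_disjoint)
qed

lemma trig_sum_self: "trig_sum f M M z = 0"
  and trig_sum_single: "trig_sum f n (n + 1) z = f (n + 1) * z powi (n + 1)"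
  by (auto simp: trig_sum_def)

section \<open>Transfer matrices\<close>

definition opn :: "complex^2^2 \<Rightarrow> real" where "opn X = onorm ((*v) X)"

definition off_diag :: "complex \<Rightarrow> complex^2^2" where
  "off_diag w = vector [vector [0, w], vector [cnj w, 0]]"

lemma opn_nonneg: "0 \<le> opn X"
  unfolding opn_def by (rule onorm_pos_le[OF matrix_vector_mul_bounded_linear])

lemma opn_add: "opn (X + Y) \<le> opn X + opn Y"
  unfolding opn_def
  using onorm_triangle[OF matrix_vector_mul_bounded_linear matrix_vector_mul_bounded_linear, of X Y] by (simp only: matrix_vector_mult_add_rdistrib[abs_def])

lemma opn_mult: "opn (X ** Y) \<le> opn X * opn Y"
  unfolding opn_def
  using onorm_compose[OF matrix_vector_mul_bounded_linear matrix_vector_mul_bounded_linear, of X Y] by (simp add: o_def matrix_vector_mul_assoc)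

lemma opn_off_diag: "opn (off_diag w) \<le> cmod w"
  unfolding opn_def
proof (rule onorm_le)
  fix v :: "complex^2"
  have "off_diag w *v v = vector [w * v$2, cnj w * v$1]"
    by (simp add: vec_eq_iff forall_2 off_diag_def matrix_vector_mult_def sum_2)
  then have "(norm (off_diag w *v v))\<^sup>2 = (cmod w * norm v)\<^sup>2"
    by (simp add: norm_vec_def L2_set_def sum_2 norm_mult power_mult_distrib algebra_simps)
  then show "norm (off_diag w *v v) \<le> cmod w * norm v"
    by (simp add: power2_eq_iff_nonneg)
qed

lemma opn_scaleR_mat1: "opn (c *\<^sub>R mat 1) \<le> \<bar>c\<bar>"
  unfolding opn_def
proof (rule onorm_le)
  fix v :: "complex^2"
  have "(c *\<^sub>R mat 1) *v v = c *\<^sub>R v"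
    by (simp add: vec_eq_iff forall_2 matrix_vector_mult_def sum_2 mat_def)
  then show "norm ((c *\<^sub>R mat 1) *v v) \<le> \<bar>c\<bar> * norm v" by simp
qed

lemma off_diag_add: "off_diag (a + b) = off_diag a + off_diag b"
  by (simp add: off_diag_def vec_eq_iff forall_2)

lemma off_diag_0: "off_diag 0 = 0"
  by (simp add: off_diag_def vec_eq_iff forall_2)

lemma opn_0: "opn 0 = 0"
  using opn_off_diag[of 0] opn_nonneg[of 0] by (simp add: off_diag_0)

text \<open>If \<open>A\<close> and \<open>B\<close> approximate \<open>X - 1\<close> and \<open>Y - 1\<close>, then in the product the approximations add up,
and the only new error is the product of the two deviations from \<open>1\<close>.\<close>

lemma opn_mult_minus_one:
  "opn (X ** Y - mat 1 - (A + B)) \<le> opn (X - mat 1 - A) + opn (Y - mat 1 - B)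
     + opn (X - mat 1) * opn (Y - mat 1)"
proof -
  have "X ** Y - mat 1 - (A + B) = (X - mat 1 - A) + (Y - mat 1 - B) + (X - mat 1) ** (Y - mat 1)"
    by (simp add: vec_eq_iff forall_2 matrix_matrix_mult_def sum_2 mat_def algebra_simps)
  then show ?thesis
    by (simp only:) (intro order_trans[OF opn_add] add_mono opn_add opn_mult order_refl)
qed

text \<open>The hyperbolic length \<open>artanh \<bar>F n\<bar>\<close>, with the phase of \<open>F n\<close>: the transfer matrix is the matrix
exponential of \<open>off_diag (nlft_coeff F n * z powi n)\<close>.\<close>

definition nlft_coeff :: "(int \<Rightarrow> complex) \<Rightarrow> int \<Rightarrow> complex" where
  "nlft_coeff F n = of_real (ln ((1 + cmod (F n)) / (1 - cmod (F n))) / 2) * sgn (F n)"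

lemma norm_nlft_coeff:
  assumes "cmod (F n) < 1"
  shows "cmod (nlft_coeff F n) = ln ((1 + cmod (F n)) / (1 - cmod (F n))) / 2"
proof -
  have "0 \<le> ln ((1 + cmod (F n)) / (1 - cmod (F n)))"
    using assms by (intro ln_ge_zero) (simp add: field_simps)
  then show ?thesis by (simp add: nlft_coeff_def norm_mult norm_sgn)
qed

lemma cosh_sinh_half_log:
  fixes a :: real
  assumes "0 \<le> a" "a < 1"
  defines "h \<equiv> ln ((1 + a) / (1 - a)) / 2"
  shows "cosh h = (1 - a\<^sup>2) powr (-1/2)" "sinh h = a * (1 - a\<^sup>2) powr (-1/2)"
proof -
  define c where "c = sqrt (1 - a\<^sup>2)"
  have pos: "1 - a > 0" "1 + a > 0" using assms by auto
  have a2: "1 - a\<^sup>2 > 0" using assms by (simp add: power_less_one_iff)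
  then have c: "c > 0" "c\<^sup>2 = 1 - a\<^sup>2" by (auto simp: c_def)
  have powr: "(1 - a\<^sup>2) powr (-1/2) = 1 / c"
    using a2 by (simp add: c_def powr_minus_divide powr_half_sqrt)
  have "(exp h)\<^sup>2 = (1 + a) / (1 - a)"
    using pos by (simp add: h_def power2_eq_square flip: exp_add)
  also have "\<dots> = ((1 + a) / c)\<^sup>2"
  proof -
    have "c\<^sup>2 = (1 - a) * (1 + a)" using c by (simp add: power2_eq_square algebra_simps)
    then show ?thesis using pos by (simp add: power_divide power2_eq_square)
  qed
  finally have e1: "exp h = (1 + a) / c"
    using pos c by (simp add: power2_eq_iff_nonneg)
  have e2: "exp (- h) = (1 - a) / c"
    using pos c by (simp add: exp_minus e1 field_simps power2_eq_square)
  show "cosh h = (1 - a\<^sup>2) powr (-1/2)" "sinh h = a * (1 - a\<^sup>2) powr (-1/2)"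
    unfolding powr cosh_def sinh_def e1 e2 using c by (simp_all add: field_simps)
qed

text \<open>The exponential series of \<open>off_diag (h * e)\<close> with \<open>e = sgn (F n) * z powi n\<close>: unless \<open>h = 0\<close>, the
number \<open>e\<close> has modulus \<open>1\<close> and the square of \<open>off_diag e\<close> is the identity.\<close>

lemma transfer_eq_cosh_sinh:
  assumes "cmod (F n) < 1" "cmod z = 1"
  defines "h \<equiv> cmod (nlft_coeff F n)"
  shows "transfer F n z = cosh h *\<^sub>R mat 1 + off_diag (of_real (sinh h) * (sgn (F n) * z powi n))"
proof -
  have "inverse z = cnj z"
    using assms(2) by (metis complex_norm_square divide_conv_cnj inverse_eq_divide mult_1)
  then have zc: "z powi (-n) = cnj (z powi n)"
    by (simp add: power_int_minus power_int_def flip: power_inverse)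
  have F: "F n = of_real (cmod (F n)) * sgn (F n)"
    by (cases "F n = 0") (simp_all add: sgn_eq)
  have cosh: "cosh h = (1 - (cmod (F n))\<^sup>2) powr (-1/2)"
    and sinh: "sinh h = cmod (F n) * (1 - (cmod (F n))\<^sup>2) powr (-1/2)"
    using cosh_sinh_half_log[of "cmod (F n)"] assms(1)
    unfolding h_def norm_nlft_coeff[where F = F and n = n, OF assms(1)] by auto
  have "of_real (sinh h) * sgn (F n) = of_real (cosh h) * F n"
    by (subst (2) F) (simp add: cosh sinh)
  then have off: "of_real (sinh h) * (sgn (F n) * z powi n) = of_real (cosh h) * (F n * z powi n)"
    by (simp only: flip: mult.assoc)
  have "transfer F n z = cosh h *\<^sub>R vector [vector [1, F n * z powi n],
      vector [cnj (F n * z powi n), 1]]"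
    unfolding transfer_def zc by (simp add: cosh)
  then show ?thesis
    unfolding off
    by (simp add: vec_eq_iff forall_2 off_diag_def mat_def scaleR_conv_of_real[where ?'a = complex])
qed

lemma norm_power_int_unit: "cmod z = 1 \<Longrightarrow> cmod (z powi n) = 1"
  by (simp add: norm_power_int)

text \<open>The bounds are the tails of the scalar exponential series, obtained by taking norms term by term.\<close>

lemma opn_transfer_minus_one:
  assumes "cmod (F n) < 1" "cmod z = 1"
  defines "h \<equiv> cmod (nlft_coeff F n)"
  shows "opn (transfer F n z - mat 1) \<le> exp h - 1"
    and "opn (transfer F n z - mat 1 - off_diag (nlft_coeff F n * z powi n)) \<le> exp h - 1 - h"
proof -
  have h: "0 \<le> h" by (simp add: h_def)
  have exp: "exp h = cosh h + sinh h" by (simp add: cosh_plus_sinh)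
  have sinh: "h \<le> sinh h"
  proof -
    have "sinh 0 - 0 \<le> sinh h - h"
      by (rule DERIV_nonneg_imp_nondecreasing[OF h, where f = "\<lambda>x. sinh x - x"])
        (auto intro!: exI derivative_eq_intros simp: cosh_real_ge_1)
    then show ?thesis by simp
  qed
  have sgn: "cmod (sgn (F n) * z powi n) \<le> 1"
    by (simp add: norm_mult norm_power_int_unit assms norm_sgn)
  have coeff: "nlft_coeff F n = of_real h * sgn (F n)"
    using norm_nlft_coeff[where F = F and n = n, OF assms(1)] by (simp add: h_def nlft_coeff_def)
  note eq = transfer_eq_cosh_sinh[where F = F and n = n and z = z, OF assms(1,2), folded h_def]
  have cosh: "0 \<le> cosh h - 1" using cosh_real_ge_1[of h] by simp
  have opn_off: "opn (off_diag (of_real c * (sgn (F n) * z powi n))) \<le> c" if "0 \<le> c" for c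
  proof -
    have "opn (off_diag (of_real c * (sgn (F n) * z powi n))) \<le> c * cmod (sgn (F n) * z powi n)"
      using opn_off_diag[of "of_real c * (sgn (F n) * z powi n)"] that by (simp add: norm_mult)
    also have "\<dots> \<le> c" using mult_left_mono[OF sgn that] by simp
    finally show ?thesis .
  qed
  have "transfer F n z - mat 1 = (cosh h - 1) *\<^sub>R mat 1 + off_diag (of_real (sinh h) * (sgn (F n) * z powi n))"
    unfolding eq by (simp add: algebra_simps)
  then have "opn (transfer F n z - mat 1) \<le> \<bar>cosh h - 1\<bar> + sinh h"
    using h by (simp only:) (intro order_trans[OF opn_add] add_mono opn_scaleR_mat1 opn_off, simp)
  then show "opn (transfer F n z - mat 1) \<le> exp h - 1" using cosh by (simp add: exp)
  have "transfer F n z - mat 1 - off_diag (nlft_coeff F n * z powi n)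
    = (cosh h - 1) *\<^sub>R mat 1 + off_diag (of_real (sinh h - h) * (sgn (F n) * z powi n))"
    unfolding eq coeff
    by (simp add: vec_eq_iff forall_2 off_diag_def mat_def scaleR_conv_of_real[where ?'a = complex] algebra_simps)
  then have "opn (transfer F n z - mat 1 - off_diag (nlft_coeff F n * z powi n)) \<le> \<bar>cosh h - 1\<bar> + (sinh h - h)"
    using sinh by (simp only:) (intro order_trans[OF opn_add] add_mono opn_scaleR_mat1 opn_off, simp)
  then show "opn (transfer F n z - mat 1 - off_diag (nlft_coeff F n * z powi n)) \<le> exp h - 1 - h"
    using cosh by (simp add: exp)
qed

lemma transfer_prod_self: "transfer_prod F M M z = mat 1"
  and transfer_prod_single: "transfer_prod F n (n + 1) z = transfer F (n + 1) z"
  by (simp_all add: transfer_prod_def)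

lemma nlft_dist_eq_opn: "nlft_dist F M N z = ln (1 + opn (transfer_prod F M N z - mat 1))"
  by (simp add: nlft_dist_eq opn_def)

lemma nlft_dist_nonneg: "0 \<le> nlft_dist F M N z"
  by (simp add: nlft_dist_eq_opn opn_nonneg)

text \<open>Taking the logarithm of \<open>1 + \<parallel>X - 1\<parallel>\<close> turns submultiplicativity into subadditivity.\<close>

lemma nlft_dist_triangle:
  assumes "L \<le> M" "M \<le> N"
  shows "nlft_dist F L N z \<le> nlft_dist F L M z + nlft_dist F M N z"
proof -
  define X where "X = transfer_prod F L M z"
  define Y where "Y = transfer_prod F M N z"
  have "opn (X ** Y - mat 1) \<le> opn (X - mat 1) + opn (Y - mat 1) + opn (X - mat 1) * opn (Y - mat 1)"
    using opn_mult_minus_one[of X Y 0 0] by simp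
  then have "1 + opn (X ** Y - mat 1) \<le> (1 + opn (X - mat 1)) * (1 + opn (Y - mat 1))"
    by (simp add: algebra_simps)
  then have "ln (1 + opn (X ** Y - mat 1)) \<le> ln ((1 + opn (X - mat 1)) * (1 + opn (Y - mat 1)))"
    by (subst ln_le_cancel_iff) (auto intro!: add_pos_nonneg mult_pos_pos opn_nonneg)
  also have "\<dots> = ln (1 + opn (X - mat 1)) + ln (1 + opn (Y - mat 1))"
    by (intro ln_mult_pos add_pos_nonneg opn_nonneg) auto
  finally show ?thesis
    using transfer_prod_append[OF assms, of F z] by (simp add: nlft_dist_eq_opn X_def Y_def)
qed

lemma nlft_dist_single:
  assumes "cmod (F (n + 1)) < 1" "cmod z = 1"
  shows "nlft_dist F n (n + 1) z \<le> cmod (nlft_coeff F (n + 1))"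
proof -
  have "1 + opn (transfer F (n+1) z - mat 1) \<le> exp (cmod (nlft_coeff F (n + 1)))"
    using opn_transfer_minus_one(1)[where F = F and n = "n + 1" and z = z, OF assms] by simp
  then have "ln (1 + opn (transfer F (n+1) z - mat 1)) \<le> ln (exp (cmod (nlft_coeff F (n + 1))))"
    by (subst ln_le_cancel_iff) (auto intro!: add_pos_nonneg opn_nonneg)
  then show ?thesis by (simp add: nlft_dist_eq_opn transfer_prod_single)
qed

section \<open>From linear sums to ordered products\<close>

text \<open>The discrete form of the Young--Lyons estimate. The interval is cut at the median index \<open>u + 1\<close>
of the control. With \<open>y = w M N powr (1/\<rho>)\<close> and \<open>\<kappa> = 2 powr (1 - 2/\<rho>) < 1\<close>, the errors of
the two halves add up to at most \<open>\<kappa> * K * y\<^sup>2\<close>; the single step and the cross terms cost at most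
\<open>21 * y\<^sup>2\<close>. The constant \<open>K\<close> solves \<open>\<kappa> * K + 21 = K\<close>.\<close>

lemma small_product_estimate:
  fixes \<rho> :: real
  assumes \<rho>: "1 \<le> \<rho>" "\<rho> < 2" and F: "\<And>n. cmod (F n) < 1" and z: "cmod z = 1"
    and w: "control w s t"
    and dom: "\<And>M N. s \<le> M \<Longrightarrow> M \<le> N \<Longrightarrow> N \<le> t \<Longrightarrow>
      cmod (trig_sum (nlft_coeff F) M N z) \<le> w M N powr (1 / \<rho>)"
  defines "K \<equiv> 21 / (1 - 2 powr (1 - 2 / \<rho>))"
  assumes MN: "s \<le> M" "M \<le> N" "N \<le> t" and small: "w M N powr (1 / \<rho>) \<le> 1 / K"
  shows "opn (transfer_prod F M N z - mat 1 - off_diag (trig_sum (nlft_coeff F) M N z))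
      \<le> K * (w M N powr (1 / \<rho>))\<^sup>2"
    and "opn (transfer_prod F M N z - mat 1) \<le> 2 * w M N powr (1 / \<rho>)"
proof -
  let ?x = "\<lambda>M N. trig_sum (nlft_coeff F) M N z"
  let ?P = "\<lambda>M N. transfer_prod F M N z"
  let ?y = "\<lambda>M N. w M N powr (1 / \<rho>)"
  let ?E = "\<lambda>M N. opn (?P M N - mat 1 - off_diag (?x M N))"
  define \<kappa> where "\<kappa> = (2::real) powr (1 - 2 / \<rho>)"
  have \<kappa>: "0 < \<kappa>" "\<kappa> < 1" using \<rho> powr_less_mono[of "1 - 2 / \<rho>" 0 2] by (auto simp: \<kappa>_def)
  have K: "K = 21 / (1 - \<kappa>)" by (simp add: K_def \<kappa>_def)
  have K21: "K \<ge> 21" "K = \<kappa> * K + 21" using \<kappa> unfolding K by (auto simp: field_simps)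
  have total: "opn (?P M N - mat 1) \<le> 2 * ?y M N"
    if "s \<le> M" "M \<le> N" "N \<le> t" "?y M N \<le> 1 / K" "?E M N \<le> K * (?y M N)\<^sup>2" for M N
  proof -
    have "?P M N - mat 1 = (?P M N - mat 1 - off_diag (?x M N)) + off_diag (?x M N)" by simp
    then have "opn (?P M N - mat 1) \<le> ?E M N + cmod (?x M N)"
      by (metis add_left_mono opn_add opn_off_diag order_trans)
    also have "\<dots> \<le> (K * ?y M N) * ?y M N + ?y M N"
      using that dom[of M N] by (simp add: power2_eq_square mult.assoc)
    also have "(K * ?y M N) * ?y M N \<le> 1 * ?y M N"
      using that K21 by (intro mult_right_mono) (auto simp: field_simps)
    finally show ?thesis by simp
  qed
  have "?E M N \<le> K * (?y M N)\<^sup>2"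
    using MN small
  proof (induction "nat (N - M)" arbitrary: M N rule: less_induct)
    case (less M N)
    show ?case
    proof (cases "M = N")
      case True
      then show ?thesis
        using K21 by (simp add: transfer_prod_self trig_sum_self off_diag_0 opn_0)
    next
      case False
      then have "M < N" using less by simp
      have wMN: "control w M N" by (rule control_subinterval[OF w]) (use less in auto)
      obtain u where u: "M \<le> u" "u < N" "w M u \<le> w M N / 2" "w (u + 1) N \<le> w M N / 2"
        using control_median[OF wMN \<open>M < N\<close>] by blast
      define y where "y = ?y M N"
      have y: "0 \<le> y" "y \<le> 1 / K" by (auto simp: y_def less)
      then have "y \<le> 1" using K21 by (auto intro: order_trans)
      have pos: "0 \<le> w M N" "0 \<le> w M u" "0 \<le> w (u+1) N" "0 \<le> w u (u+1)"
        using u less by (auto intro!: control_nonneg[OF wMN])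
      have le: "w M u \<le> w M N" "w u (u+1) \<le> w M N" "w (u+1) N \<le> w M N"
        using u less by (auto intro!: control_mono[OF wMN])
      have yle: "?y M u \<le> y" "?y u (u+1) \<le> y" "?y (u+1) N \<le> y"
        unfolding y_def using \<rho> pos le by (auto intro!: powr_mono2)
      have half: "(?y a b)\<^sup>2 \<le> \<kappa> / 2 * y\<^sup>2" if "w a b \<le> w M N / 2" "0 \<le> w a b" for a b
      proof -
        have "?y a b \<le> (w M N / 2) powr (1 / \<rho>)" using that \<rho> by (intro powr_mono2) auto
        also have "\<dots> = 2 powr (- (1 / \<rho>)) * y" using pos by (simp add: half_powr y_def)
        finally have "(?y a b)\<^sup>2 \<le> (2 powr (- (1 / \<rho>)) * y)\<^sup>2" by (intro power_mono) auto
        also have "\<dots> = (2 powr (- (1 / \<rho>)))\<^sup>2 * y\<^sup>2" by (simp add: power_mult_distrib)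
        also have "((2::real) powr (- (1 / \<rho>)))\<^sup>2 = \<kappa> / 2"
          by (simp add: \<kappa>_def power2_eq_square powr_diff powr_minus_divide flip: powr_add)
        finally show ?thesis .
      qed
      have E1: "?E M u \<le> K * (?y M u)\<^sup>2" and E2: "?E (u+1) N \<le> K * (?y (u+1) N)\<^sup>2"
        using less u yle y by (auto intro!: less.hyps simp: y_def)
      have E1': "?E M u \<le> K * (\<kappa> / 2 * y\<^sup>2)" and E2': "?E (u+1) N \<le> K * (\<kappa> / 2 * y\<^sup>2)"
        using K21 by (auto intro!: order_trans[OF E1] order_trans[OF E2] mult_left_mono
            half u pos simp del: times_divide_eq_left)
      have P1: "opn (?P M u - mat 1) \<le> 2 * y" and P2: "opn (?P (u+1) N - mat 1) \<le> 2 * y"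
        using total[OF _ _ _ _ E1] total[OF _ _ _ _ E2] less u yle y by auto
      define h where "h = cmod (nlft_coeff F (u+1))"
      have "h \<le> y"
        using dom[of u "u+1"] less u yle z
        by (simp add: h_def trig_sum_single norm_mult norm_power_int_unit)
      have h: "0 \<le> h" "h \<le> 1" using \<open>h \<le> y\<close> \<open>y \<le> 1\<close> by (auto simp: h_def)
      have "exp h \<le> 1 + h + h\<^sup>2" using exp_bound[OF h] .
      moreover have "h\<^sup>2 \<le> y\<^sup>2" using \<open>h \<le> y\<close> h by (intro power_mono)
      moreover have "h\<^sup>2 \<le> h" using h by (simp add: power2_eq_square mult_left_le)
      moreover note opn_transfer_minus_one[where F = F and n = "u+1" and z = z, OF F z, folded h_def]
      ultimately have Q: "opn (?P u (u+1) - mat 1) \<le> 2 * y" and EQ: "?E u (u+1) \<le> y\<^sup>2"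
        using \<open>h \<le> y\<close> by (simp_all add: transfer_prod_single trig_sum_single)
      have mulle: "opn A * opn B \<le> a * b" if "opn A \<le> a" "opn B \<le> b" "0 \<le> a" for A B a b
        using that by (intro mult_mono opn_nonneg)
      have P12: "opn (?P M (u+1) - mat 1) \<le> 8 * y"
      proof -
        have "opn (?P M u ** ?P u (u+1) - mat 1 - (0 + 0)) \<le> 2 * y + 2 * y + 2 * y * (2 * y)"
          using P1 Q y
          by (intro order_trans[OF opn_mult_minus_one] add_mono mulle) auto
        also have "2 * y * (2 * y) \<le> 4 * y" using y \<open>y \<le> 1\<close> by (simp add: mult_left_le)
        finally show ?thesis using u transfer_prod_append[of M u "u+1" F z] by simp
      qed
      have E12: "?E M (u+1) \<le> K * (\<kappa> / 2 * y\<^sup>2) + y\<^sup>2 + 4 * y\<^sup>2"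
      proof -
        have "?E M (u+1) \<le> K * (\<kappa> / 2 * y\<^sup>2) + y\<^sup>2 + 2 * y * (2 * y)"
          using u transfer_prod_append[of M u "u+1" F z] trig_sum_append[of M u "u+1" "nlft_coeff F" z] E1' EQ P1 Q y
          by (simp only: off_diag_add) (intro order_trans[OF opn_mult_minus_one] add_mono mulle, auto)
        then show ?thesis by (simp add: power2_eq_square)
      qed
      have "?E M N \<le> (K * (\<kappa> / 2 * y\<^sup>2) + y\<^sup>2 + 4 * y\<^sup>2) + K * (\<kappa> / 2 * y\<^sup>2) + 8 * y * (2 * y)"
        using u transfer_prod_append[of M "u+1" N F z] trig_sum_append[of M "u+1" N "nlft_coeff F" z] E12 E2' P12 P2 y
        by (simp only: off_diag_add) (intro order_trans[OF opn_mult_minus_one] add_mono mulle, auto)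
      also have "\<dots> = (\<kappa> * K + 21) * y\<^sup>2" by (simp add: power2_eq_square algebra_simps)
      finally show ?thesis using K21 by (simp add: y_def)
    qed
  qed
  then show "?E M N \<le> K * (?y M N)\<^sup>2" "opn (?P M N - mat 1) \<le> 2 * ?y M N"
    using total MN small by blast+
qed

text \<open>For intervals with small control this is \<open>small_product_estimate\<close>. A larger interval is exhausted greedily: a
maximal initial piece with control at most \<open>\<delta>\<close>, then one single step, then the rest. The first
two together have control more than \<open>\<delta>\<close>, so the cost \<open>3 * w powr (1/\<rho>)\<close> of passing them is
at most a multiple of \<open>w\<close>, and these multiples add up by superadditivity.\<close>

lemma nlft_dist_le_control:
  fixes \<rho> :: real
  assumes \<rho>: "1 \<le> \<rho>" "\<rho> < 2"
  obtains C where "1 \<le> C" and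
    "\<And>F z w s t M N. (\<And>n. cmod (F n) < 1) \<Longrightarrow> cmod z = 1 \<Longrightarrow> control w s t \<Longrightarrow>
      (\<And>M N. s \<le> M \<Longrightarrow> M \<le> N \<Longrightarrow> N \<le> t \<Longrightarrow>
        cmod (trig_sum (nlft_coeff F) M N z) \<le> w M N powr (1 / \<rho>)) \<Longrightarrow>
      s \<le> M \<Longrightarrow> M \<le> N \<Longrightarrow> N \<le> t \<Longrightarrow>
      nlft_dist F M N z \<le> C * (w M N powr (1 / \<rho>) + w M N)"
proof -
  define K where "K = 21 / (1 - (2::real) powr (1 - 2 / \<rho>))"
  have K: "K > 0" using \<rho> powr_less_mono[of "1 - 2 / \<rho>" 0 2] by (simp add: K_def)
  \<comment> \<open>The threshold up to which \<open>small_product_estimate\<close> applies.\<close>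
  define \<delta> where "\<delta> = (1 / K) powr \<rho>"
  have \<delta>: "\<delta> > 0" "\<delta> powr (1 / \<rho>) = 1 / K" using K \<rho> by (auto simp: \<delta>_def powr_powr)
  define K' where "K' = 3 * \<delta> powr (1 / \<rho> - 1)"
  have large: "3 * a powr (1 / \<rho>) \<le> K' * a" if "a > \<delta>" for a
  proof -
    have "a powr (1 / \<rho>) = a powr (1 / \<rho> - 1) * a"
      using powr_add[of a "1 / \<rho> - 1" 1] that \<delta> by simp
    also have "\<dots> \<le> \<delta> powr (1 / \<rho> - 1) * a"
      using that \<delta> \<rho> by (auto intro!: mult_right_mono powr_mono2')
    finally show ?thesis by (simp add: K'_def)
  qed
  show thesis
  proof (rule that[of "2 + K'"])
    show "1 \<le> 2 + K'" by (simp add: K'_def)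
    fix F z w s t M N
    assume F: "\<And>n. cmod (F n) < 1" and z: "cmod z = 1" and w: "control w s t"
      and dom: "\<And>M N. s \<le> M \<Longrightarrow> M \<le> N \<Longrightarrow> N \<le> t \<Longrightarrow>
        cmod (trig_sum (nlft_coeff F) M N z) \<le> w M N powr (1 / \<rho>)"
      and MN: "s \<le> M" "M \<le> N" "N \<le> t"
    let ?d = "\<lambda>M N. nlft_dist F M N z"
    let ?y = "\<lambda>M N. w M N powr (1 / \<rho>)"
    have small: "?d M N \<le> 2 * ?y M N" if "s \<le> M" "M \<le> N" "N \<le> t" "w M N \<le> \<delta>" for M N
    proof -
      have "?y M N \<le> \<delta> powr (1 / \<rho>)"
        using that \<rho> control_nonneg[OF w] by (intro powr_mono2) auto
      then have "opn (transfer_prod F M N z - mat 1) \<le> 2 * ?y M N"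
        using that \<delta> by (intro small_product_estimate(2)[OF \<rho> F z w dom]) (auto simp: K_def)
      moreover have "?d M N \<le> opn (transfer_prod F M N z - mat 1)"
        unfolding nlft_dist_eq_opn by (rule ln_add_one_self_le_self[OF opn_nonneg])
      ultimately show ?thesis by linarith
    qed
    have "?d M N \<le> 2 * ?y M N + K' * w M N"
      using MN
    proof (induction "nat (N - M)" arbitrary: M rule: less_induct)
      case (less M)
      have K'w: "0 \<le> K' * w M N"
        using less control_nonneg[OF w] by (auto intro!: mult_nonneg_nonneg simp: K'_def)
      show ?case
      proof (cases "w M N \<le> \<delta>")
        case True
        then show ?thesis using small[of M N] less.prems K'w by linarith
      next
        case False
        define U where "U = {u \<in> {M..<N}. w M u \<le> \<delta>}"
        have "M \<noteq> N" using False \<delta> control_diag[OF w, of M] less.prems by auto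
        then have "M \<in> U" using less.prems \<delta> control_diag[OF w, of M] by (auto simp: U_def)
        have fin: "finite U" by (rule finite_subset[of _ "{M..<N}"]) (auto simp: U_def)
        define u where "u = Max U"
        have u: "M \<le> u" "u < N" "w M u \<le> \<delta>"
          using Max_in[OF fin] \<open>M \<in> U\<close> by (auto simp: u_def U_def)
        have big: "w M (u + 1) > \<delta>"
        proof (cases "u + 1 = N")
          case True
          then show ?thesis using False by simp
        next
          case ne: False
          then have "u + 1 \<notin> U" using Max_ge[OF fin, of "u + 1"] by (auto simp: u_def)
          then show ?thesis using u ne by (auto simp: U_def)
        qed
        have le: "0 \<le> w M u" "w M u \<le> w M (u+1)" "0 \<le> w u (u+1)" "w u (u+1) \<le> w M (u+1)"
          "w (u+1) N \<le> w M N" "0 \<le> w (u+1) N"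
          using u less.prems by (auto intro!: control_mono[OF w] control_nonneg[OF w])
        have le': "?y M u \<le> ?y M (u+1)" "?y u (u+1) \<le> ?y M (u+1)" "?y (u+1) N \<le> ?y M N"
          using le \<rho> by (auto intro!: powr_mono2)
        have "?d M N \<le> (?d M u + ?d u (u+1)) + ?d (u+1) N"
          using nlft_dist_triangle[of M u "u+1" F z] nlft_dist_triangle[of M "u+1" N F z] u by linarith
        also have "?d M u \<le> 2 * ?y M u" using small u less.prems by auto
        also have "?d u (u+1) \<le> ?y u (u+1)"
          using nlft_dist_single[where F = F and n = u and z = z, OF F z] dom[of u "u+1"] u less.prems z
          by (simp add: trig_sum_single norm_mult norm_power_int_unit)
        also have "?d (u+1) N \<le> 2 * ?y (u+1) N + K' * w (u+1) N"
          using u less.prems by (intro less.hyps) auto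
        finally have "?d M N \<le> 3 * ?y M (u+1) + 2 * ?y M N + K' * w (u+1) N"
          using le' by linarith
        also have "\<dots> \<le> 2 * ?y M N + K' * (w M (u+1) + w (u+1) N)"
          using large[OF big] by (simp add: distrib_left)
        also have "\<dots> \<le> 2 * ?y M N + K' * w M N"
          using u less.prems control_superadd[OF w, of M "u+1" N]
          by (intro add_left_mono mult_left_mono) (auto simp: K'_def)
        finally show ?thesis .
      qed
    qed
    also have "\<dots> \<le> (2 + K') * (?y M N + w M N)"
      using MN control_nonneg[OF w, of M N] by (simp add: algebra_simps K'_def)
    finally show "?d M N \<le> (2 + K') * (?y M N + w M N)" .
  qed
qed

text \<open>Each step of the partition costs at most \<open>C * (w powr (1/\<rho>) + w)\<close>. The \<open>\<rho>\<close>-th powers are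
of the order \<open>w + w powr \<rho>\<close>, and both \<open>w\<close> and \<open>w powr \<rho>\<close> are superadditive, so they sum up over
the partition.\<close>

lemma variation_sum_le_control:
  fixes \<rho> :: real
  assumes \<rho>: "1 \<le> \<rho>" "\<rho> < 2"
  obtains C where "1 \<le> C" and
    "\<And>F z w s t K N. (\<And>n. cmod (F n) < 1) \<Longrightarrow> cmod z = 1 \<Longrightarrow> control w s t \<Longrightarrow>
      (\<And>M N. s \<le> M \<Longrightarrow> M \<le> N \<Longrightarrow> N \<le> t \<Longrightarrow>
        cmod (trig_sum (nlft_coeff F) M N z) \<le> w M N powr (1 / \<rho>)) \<Longrightarrow>
      (\<And>j. j < K \<Longrightarrow> N j \<le> N (Suc j)) \<Longrightarrow> s \<le> N 0 \<Longrightarrow> N K \<le> t \<Longrightarrow>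
      (\<Sum>j<K. nlft_dist F (N j) (N (Suc j)) z powr \<rho>) powr (1 / \<rho>)
        \<le> C * (w s t powr (1 / \<rho>) + w s t)"
proof -
  obtain C where C: "1 \<le> C" and dist:
    "\<And>F z w s t M N. (\<And>n. cmod (F n) < 1) \<Longrightarrow> cmod z = 1 \<Longrightarrow> control w s t \<Longrightarrow>
      (\<And>M N. s \<le> M \<Longrightarrow> M \<le> N \<Longrightarrow> N \<le> t \<Longrightarrow>
        cmod (trig_sum (nlft_coeff F) M N z) \<le> w M N powr (1 / \<rho>)) \<Longrightarrow>
      s \<le> M \<Longrightarrow> M \<le> N \<Longrightarrow> N \<le> t \<Longrightarrow>
      nlft_dist F M N z \<le> C * (w M N powr (1 / \<rho>) + w M N)"
    using nlft_dist_le_control[OF \<rho>] by blast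
  show thesis
  proof (rule that[of "4 * C"])
    show "1 \<le> 4 * C" using C by simp
    fix F z w s t and K :: nat and N
    assume F: "\<And>n. cmod (F n) < 1" and z: "cmod z = 1" and w: "control w s t"
      and dom: "\<And>M N. s \<le> M \<Longrightarrow> M \<le> N \<Longrightarrow> N \<le> t \<Longrightarrow>
        cmod (trig_sum (nlft_coeff F) M N z) \<le> w M N powr (1 / \<rho>)"
      and N: "\<And>j. j < K \<Longrightarrow> N j \<le> N (Suc j)" "s \<le> N 0" "N K \<le> t"
    have mono: "N a \<le> N b" if "a \<le> b" "b \<le> K" for a b
      using that
    proof (induction b)
      case (Suc b)
      then show ?case using N(1)[of b] by (cases "a = Suc b") auto
    qed simp
    have range: "s \<le> N j \<and> N (Suc j) \<le> t" if "j < K" for j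
      using mono[of 0 j] mono[of "Suc j" K] N that by auto
    let ?w = "\<lambda>j. w (N j) (N (Suc j))"
    let ?c = "(2 * C) powr \<rho>"
    have wnn: "0 \<le> ?w j" if "j < K" for j
      using range[OF that] N that by (intro control_nonneg[OF w]) auto
    have "nlft_dist F (N j) (N (Suc j)) z powr \<rho> \<le> ?c * (?w j + ?w j powr \<rho>)" if "j < K" for j
    proof -
      have "nlft_dist F (N j) (N (Suc j)) z \<le> C * (?w j powr (1 / \<rho>) + ?w j)"
        using range[OF that] N that by (intro dist[OF F z w dom]) auto
      then have "nlft_dist F (N j) (N (Suc j)) z powr \<rho> \<le> (C * (?w j powr (1 / \<rho>) + ?w j)) powr \<rho>"
        using \<rho> by (intro powr_mono2 nlft_dist_nonneg) auto
      also have "\<dots> = C powr \<rho> * (?w j powr (1 / \<rho>) + ?w j) powr \<rho>"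
        using C wnn[OF that] by (simp add: powr_mult)
      also have "\<dots> \<le> C powr \<rho> * (2 powr \<rho> * ((?w j powr (1 / \<rho>)) powr \<rho> + ?w j powr \<rho>))"
        using \<rho> wnn[OF that] by (intro mult_left_mono powr_add_le) auto
      also have "\<dots> = ?c * (?w j + ?w j powr \<rho>)"
        using \<rho> C wnn[OF that] by (simp add: powr_powr powr_mult)
      finally show ?thesis .
    qed
    then have "(\<Sum>j<K. nlft_dist F (N j) (N (Suc j)) z powr \<rho>) \<le> (\<Sum>j<K. ?c * (?w j + ?w j powr \<rho>))"
      by (intro sum_mono) auto
    also have "\<dots> = ?c * ((\<Sum>j<K. ?w j) + (\<Sum>j<K. ?w j powr \<rho>))"
      by (simp only: sum.distrib flip: sum_distrib_left)
    also have "\<dots> \<le> ?c * (w s t + w s t powr \<rho>)"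
    proof -
      have "N 0 \<le> N K" "(\<Sum>j<K. ?w j) \<le> w (N 0) (N K)" "(\<Sum>j<K. ?w j powr \<rho>) \<le> w (N 0) (N K) powr \<rho>"
        using control_sum[OF w, of K N] control_sum[OF control_powr[OF w \<rho>(1)], of K N] N by auto
      moreover have "w (N 0) (N K) \<le> w s t" "0 \<le> w (N 0) (N K)"
        using N calculation(1) by (auto intro!: control_mono[OF w] control_nonneg[OF w])
      moreover from this have "w (N 0) (N K) powr \<rho> \<le> w s t powr \<rho>" using \<rho> by (intro powr_mono2) auto
      ultimately show ?thesis by (intro mult_left_mono add_mono) auto
    qed
    finally have "(\<Sum>j<K. nlft_dist F (N j) (N (Suc j)) z powr \<rho>) powr (1 / \<rho>)
        \<le> (?c * (w s t + w s t powr \<rho>)) powr (1 / \<rho>)"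
      using \<rho> by (intro powr_mono2 sum_nonneg) auto
    also have "N 0 \<le> N K" using control_sum[OF w, of K N] N by auto
    then have wst: "0 \<le> w s t" using N by (intro control_nonneg[OF w]) auto
    have "(?c * (w s t + w s t powr \<rho>)) powr (1 / \<rho>) = 2 * C * (w s t + w s t powr \<rho>) powr (1 / \<rho>)"
      using wst C \<rho> by (simp add: powr_mult powr_powr)
    also have "\<dots> \<le> 2 * C * (2 * (w s t powr (1 / \<rho>) + w s t))"
    proof -
      have "(w s t + w s t powr \<rho>) powr (1 / \<rho>)
        \<le> 2 powr (1 / \<rho>) * (w s t powr (1 / \<rho>) + (w s t powr \<rho>) powr (1 / \<rho>))"
        using wst \<rho> by (intro powr_add_le) auto
      also have "(w s t powr \<rho>) powr (1 / \<rho>) = w s t" using wst \<rho> by (simp add: powr_powr)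
      also have "2 powr (1 / \<rho>) * (w s t powr (1 / \<rho>) + w s t)
        \<le> 2 * (w s t powr (1 / \<rho>) + w s t)"
        using powr_mono[of "1 / \<rho>" 1 2] \<rho> wst by (intro mult_right_mono) auto
      finally show ?thesis using C by (intro mult_left_mono) auto
    qed
    finally show "(\<Sum>j<K. nlft_dist F (N j) (N (Suc j)) z powr \<rho>) powr (1 / \<rho>)
        \<le> 4 * C * (w s t powr (1 / \<rho>) + w s t)"
      using C wst by (simp add: algebra_simps)
  qed
qed

section \<open>The Hausdorff--Young inequality\<close>

lemma measurable_cis[measurable]: "(\<lambda>t. cis (2 * pi * t)) \<in> borel_measurable borel"
  by (intro borel_measurable_continuous_onI continuous_intros)

lemma measurable_power_int[measurable]: "(\<lambda>z::complex. z powi k) \<in> borel_measurable borel"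
  by (rule borel_measurable_continuous_countable_exceptions[of "{0}"]) (auto intro!: continuous_intros)

lemma nn_integral_circle:
  assumes [measurable]: "g \<in> borel_measurable borel"
  shows "(\<integral>\<^sup>+z. g z \<partial>circle_measure) = (\<integral>\<^sup>+t. g (cis (2 * pi * t)) * indicator {0..1} t \<partial>lborel)"
  unfolding circle_measure_def
  by (subst nn_integral_distr) (auto simp: nn_integral_restrict_space measurable_restrict_space1)

lemma AE_circle: "AE z in circle_measure. cmod z = 1"
  unfolding circle_measure_def
  by (subst AE_distr_iff) (auto simp: measurable_restrict_space1)

lemma emeasure_space_circle: "emeasure circle_measure (space circle_measure) = 1"
  using circle_measure_carrier(2) by (simp add: circle_measure_def)

lemma has_bochner_integral_character:
  "has_bochner_integral lborel (\<lambda>t::real. indicator {0..1} t *\<^sub>R cis (2 * pi * of_int k * t))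
     (if k = 0 then 1 else 0)"
proof (cases "k = 0")
  case True
  have "has_bochner_integral lborel (\<lambda>t::real. indicator {0..1} t *\<^sub>R (1::complex)) (1 - 0)"
    using has_bochner_integral_FTC_Icc[of 0 1 of_real "\<lambda>_. 1::complex",
        OF _ has_vector_derivative_real_field[OF DERIV_ident]] by simp
  then show ?thesis using True by simp
next
  case False
  define c where "c = 2 * of_real pi * \<i> * of_int k"
  have c: "c \<noteq> 0" using False by (simp add: c_def)
  have cis: "cis (2 * pi * of_int k * t) = exp (of_real t * c)" for t
    by (simp add: cis_conv_exp c_def mult_ac)
  have "has_bochner_integral lborel (\<lambda>t::real. indicator {0..1} t *\<^sub>R exp (of_real t * c))
      (exp (of_real 1 * c) / c - exp (of_real 0 * c) / c)"
    using c by (intro has_bochner_integral_FTC_Icc has_vector_derivative_real_field)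
      (auto intro!: derivative_eq_intros continuous_intros)
  moreover have "exp c = 1"
    using exp_integer_2pi[of "of_int k"] by (simp add: c_def mult_ac)
  ultimately show ?thesis using False by (simp add: cis)
qed

text \<open>Expand the square; only the diagonal terms survive integration over the circle.\<close>

lemma parseval_trig:
  assumes "finite A"
  shows "(\<integral>\<^sup>+z. ennreal ((cmod (\<Sum>n\<in>A. f n * z powi n))\<^sup>2) \<partial>circle_measure)
    = ennreal (\<Sum>n\<in>A. (cmod (f n))\<^sup>2)"
proof -
  let ?S = "\<lambda>t::real. \<Sum>n\<in>A. f n * cis (2 * pi * t) powi n"
  have "has_bochner_integral lborel (\<lambda>t. \<Sum>n\<in>A. \<Sum>m\<in>A.
      (f n * cnj (f m)) * (indicator {0..1} t *\<^sub>R cis (2 * pi * of_int (n - m) * t)))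
      (\<Sum>n\<in>A. \<Sum>m\<in>A. (f n * cnj (f m)) * (if n - m = 0 then 1 else 0))"
    by (intro has_bochner_integral_sum has_bochner_integral_mult_right has_bochner_integral_character)
  also have "(\<Sum>n\<in>A. \<Sum>m\<in>A. (f n * cnj (f m)) * (if n - m = 0 then 1 else 0))
      = of_real (\<Sum>n\<in>A. (cmod (f n))\<^sup>2)"
    using assms by (simp add: sum.delta if_distrib cong: if_cong flip: complex_norm_square)
  also have "(\<lambda>t. \<Sum>n\<in>A. \<Sum>m\<in>A.
      (f n * cnj (f m)) * (indicator {0..1} t *\<^sub>R cis (2 * pi * of_int (n - m) * t)))
    = (\<lambda>t. of_real ((cmod (?S t))\<^sup>2 * indicator {0..1} t))"
  proof
    fix t :: real
    have cis: "cis (2 * pi * t) powi n * cnj (cis (2 * pi * t) powi m) = cis (2 * pi * of_int (n - m) * t)" for n m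
      by (simp add: cis_power_int cis_cnj cis_mult algebra_simps)
    have "of_real ((cmod (?S t))\<^sup>2) = ?S t * cnj (?S t)" by (rule complex_norm_square)
    also have "\<dots> = (\<Sum>n\<in>A. \<Sum>m\<in>A. (f n * cnj (f m)) * (cis (2 * pi * t) powi n * cnj (cis (2 * pi * t) powi m)))"
      by (simp add: sum_product mult_ac)
    finally show "(\<Sum>n\<in>A. \<Sum>m\<in>A.
      (f n * cnj (f m)) * (indicator {0..1} t *\<^sub>R cis (2 * pi * of_int (n - m) * t)))
      = of_real ((cmod (?S t))\<^sup>2 * indicator {0..1} t)"
      unfolding cis by (simp split: split_indicator)
  qed
  finally have "has_bochner_integral lborel (\<lambda>t. (cmod (?S t))\<^sup>2 * indicator {0..1} t) (\<Sum>n\<in>A. (cmod (f n))\<^sup>2)"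
    by (auto dest: has_bochner_integral_bounded_linear[OF bounded_linear_Re])
  then have "(\<integral>\<^sup>+t. ennreal ((cmod (?S t))\<^sup>2 * indicator {0..1} t) \<partial>lborel) = ennreal (\<Sum>n\<in>A. (cmod (f n))\<^sup>2)"
    by (subst nn_integral_eq_integral) (auto simp: has_bochner_integral_iff)
  moreover have "ennreal ((cmod (?S t))\<^sup>2 * indicator {0..1} t) = ennreal ((cmod (?S t))\<^sup>2) * indicator {0..1} t" for t
    by (simp split: split_indicator)
  ultimately show ?thesis by (subst nn_integral_circle) simp_all
qed

text \<open>Marcinkiewicz interpolation between \<open>\<ell>\<^sup>1 \<rightarrow> L\<^sup>\<infinity>\<close> and \<open>\<ell>\<^sup>2 \<rightarrow> L\<^sup>2\<close>. Where the transform lies between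
\<open>2\<^sup>k\<close> and \<open>2\<^sup>k\<^sup>+\<^sup>1\<close>, drop the coefficients that exceed a height depending on \<open>k\<close>: by
normalization they contribute at most \<open>2\<^sup>k\<^sup>-\<^sup>1\<close>, so the rest is still at least
\<open>2\<^sup>k\<^sup>-\<^sup>1\<close> there. Parseval's identity controls its square, and a coefficient
appears only in the levels \<open>k\<close> whose height exceeds it, which form a geometric series.\<close>

lemma hausdorff_young_normalized:
  fixes p q :: real
  assumes p: "1 < p" "p < 2" and q: "q = p / (p - 1)"
  obtains H where "0 \<le> H" and
    "\<And>f A. finite A \<Longrightarrow> (\<Sum>n\<in>A. cmod (f n) powr p) \<le> 1 \<Longrightarrow>
      (\<integral>\<^sup>+z. ennreal (cmod (\<Sum>n\<in>A. f n * z powi n) powr q) \<partial>circle_measure) \<le> ennreal H"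
proof -
  have q2: "q > 2" and pq: "(p - 1) * q = p" using p by (auto simp: q field_simps)
  \<comment> \<open>The \<open>q\<close>-th power of \<open>2 ^ k\<close> is \<open>b ^ k\<close> times its square.\<close>
  define b where "b = (2::real) powr (q - 2)"
  have b: "b > 1" unfolding b_def using q2 by simp
  define c where "c = 4 * 2 powr q"
  define H where "H = 1 + c * (b * (b / (b - 1)))"
  show thesis
  proof (rule that[of H])
    show "0 \<le> H" using b by (simp add: H_def c_def)
    fix f :: "int \<Rightarrow> complex" and A
    assume A: "finite A" and mass: "(\<Sum>n\<in>A. cmod (f n) powr p) \<le> 1"
    let ?S = "\<lambda>B z. \<Sum>n\<in>B. f n * z powi n"
    \<comment> \<open>The coefficients that are kept at level \<open>k\<close>: those of size at most \<open>(2 powr (k - 1)) powr (- 1 / (p - 1))\<close>.\<close>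
    define B where "B k = {n \<in> A. 2 powr (real k - 1) * cmod (f n) powr (p - 1) \<le> 1}" for k :: nat
    have BA: "B k \<subseteq> A" "finite (B k)" for k using A by (auto simp: B_def)
    obtain L :: nat where L: "(\<Sum>n\<in>A. cmod (f n)) < 2 ^ L"
      using real_arch_pow[of 2] by auto
    have rest: "(\<Sum>n\<in>A - B k. cmod (f n)) \<le> 2 powr (real k - 1)" for k
    proof -
      have "(\<Sum>n\<in>A - B k. cmod (f n)) \<le> (\<Sum>n\<in>A - B k. 2 powr (real k - 1) * cmod (f n) powr p)"
      proof (rule sum_mono)
        fix n assume "n \<in> A - B k"
        then have "1 * cmod (f n) \<le> (2 powr (real k - 1) * cmod (f n) powr (p - 1)) * cmod (f n)"
          by (intro mult_right_mono) (auto simp: B_def)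
        also have "\<dots> = 2 powr (real k - 1) * cmod (f n) powr p"
          using powr_add[of "cmod (f n)" "p - 1" 1] by (cases "f n = 0") auto
        finally show "cmod (f n) \<le> 2 powr (real k - 1) * cmod (f n) powr p" by simp
      qed
      also have "\<dots> \<le> (\<Sum>n\<in>A. 2 powr (real k - 1) * cmod (f n) powr p)"
        using A by (intro sum_mono2) auto
      also have "\<dots> \<le> 2 powr (real k - 1) * 1"
        unfolding sum_distrib_left[symmetric] by (intro mult_left_mono mass) auto
      finally show ?thesis by simp
    qed
    have pointwise: "cmod (?S A z) powr q \<le> 1 + (\<Sum>k<L. c * b ^ k * (cmod (?S (B k) z))\<^sup>2)"
      if z: "cmod z = 1" for z
    proof (cases "cmod (?S A z) \<le> 1")
      case True
      have "cmod (?S A z) powr q \<le> 1 powr q" using True q2 by (intro powr_mono2) auto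
      moreover have "0 \<le> (\<Sum>k<L. c * b ^ k * (cmod (?S (B k) z))\<^sup>2)"
        using b by (intro sum_nonneg) (auto simp: c_def)
      ultimately show ?thesis by simp
    next
      case False
      have norm: "cmod (?S X z) \<le> (\<Sum>n\<in>X. cmod (f n))" for X
        by (rule order_trans[OF norm_sum]) (simp add: norm_mult norm_power_int_unit z)
      have "cmod (?S A z) \<le> 2 ^ L" using norm[of A] L by linarith
      then obtain k' where k': "k' \<le> L" "\<And>i. i < k' \<Longrightarrow> \<not> cmod (?S A z) \<le> 2 ^ i" "cmod (?S A z) \<le> 2 ^ k'"
        using ex_least_nat_le[of "\<lambda>i. cmod (?S A z) \<le> 2 ^ i" L] by blast
      with False obtain k where k: "k' = Suc k" by (cases k') auto
      have lo: "2 ^ k < cmod (?S A z)" and hi: "cmod (?S A z) \<le> 2 ^ Suc k" and "k < L"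
        using k' k by force+
      have pw: "2 powr (real k - 1) = 2 ^ k / (2::real)" by (simp add: powr_diff powr_realpow)
      have "?S A z = ?S (B k) z + ?S (A - B k) z"
        using sum.subset_diff[OF BA(1) A, of "\<lambda>n. f n * z powi n" k] by (simp add: add.commute)
      then have "cmod (?S A z) \<le> cmod (?S (B k) z) + cmod (?S (A - B k) z)"
        by (simp only: norm_triangle_ineq)
      also have "\<dots> \<le> cmod (?S (B k) z) + 2 ^ k / 2"
        using order_trans[OF norm rest] pw by (metis add_left_mono)
      finally have "cmod (?S A z) \<le> cmod (?S (B k) z) + 2 ^ k / 2" .
      then have "2 ^ k \<le> 2 * cmod (?S (B k) z)" using lo by simp
      then have "(2 ^ k)\<^sup>2 \<le> (2 * cmod (?S (B k) z))\<^sup>2" by (intro power_mono) auto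
      then have key: "(2 ^ k)\<^sup>2 \<le> 4 * (cmod (?S (B k) z))\<^sup>2" by (simp add: power_mult_distrib)
      have "cmod (?S A z) powr q \<le> (2 ^ Suc k) powr q" using hi q2 by (intro powr_mono2) auto
      also have "\<dots> = 2 powr q * (b ^ k * (2 ^ k)\<^sup>2)"
      proof -
        have bk: "b ^ k = 2 powr ((q - 2) * real k)"
          unfolding b_def by (simp add: powr_powr flip: powr_realpow)
        have sq: "((2::real) ^ k)\<^sup>2 = 2 powr (2 * real k)"
          by (simp add: powr_realpow[symmetric] power2_eq_square flip: powr_add)
        have "((2::real) ^ Suc k) powr q = (2 powr (real k + 1)) powr q"
          by (simp add: powr_add powr_realpow mult.commute)
        also have "\<dots> = 2 powr (q + ((q - 2) * real k + 2 * real k))"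
          by (simp add: powr_powr algebra_simps)
        finally show ?thesis unfolding bk sq by (simp add: powr_add)
      qed
      also have "\<dots> \<le> 2 powr q * (b ^ k * (4 * (cmod (?S (B k) z))\<^sup>2))"
        using b key by (intro mult_left_mono) auto
      also have "\<dots> = c * b ^ k * (cmod (?S (B k) z))\<^sup>2" by (simp add: c_def)
      also have "\<dots> \<le> (\<Sum>k<L. c * b ^ k * (cmod (?S (B k) z))\<^sup>2)"
        using \<open>k < L\<close> b by (intro member_le_sum) (auto simp: c_def)
      finally show ?thesis by simp
    qed
    have level: "(\<Sum>k | k < L \<and> n \<in> B k. b ^ k) * (cmod (f n))\<^sup>2 \<le> b * (b / (b - 1)) * cmod (f n) powr p"
      if "n \<in> A" for n
    proof (cases "f n = 0")
      case True
      then show ?thesis by simp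
    next
      case False
      define a where "a = cmod (f n)"
      have a: "a > 0" using False by (simp add: a_def)
      define T where "T = b * a powr (p - 2)"
      have "b ^ k \<le> T" if "n \<in> B k" for k
      proof -
        have "2 powr (real k - 1) * a powr (p - 1) \<le> 1" using that by (simp add: B_def a_def)
        then have "2 powr (real k - 1) \<le> 1 / a powr (p - 1)"
          using a by (simp add: field_simps)
        also have "\<dots> = a powr (- (p - 1))" by (rule powr_minus_divide[symmetric])
        finally have "2 powr (real k - 1) \<le> a powr (- (p - 1))" .
        then have "(2 powr (real k - 1)) powr (q - 2) \<le> (a powr (- (p - 1))) powr (q - 2)"
          using q2 by (intro powr_mono2) auto
        also have "\<dots> = a powr (p - 2)"
        proof -
          have "- (p - 1) * (q - 2) = p - 2" using pq by (simp add: algebra_simps)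
          then show ?thesis by (simp only: powr_powr)
        qed
        also have "(2 powr (real k - 1)) powr (q - 2) = b powr (real k - 1)"
          by (simp add: b_def powr_powr mult.commute)
        also have "\<dots> = b ^ k / b" using b by (simp add: powr_diff powr_realpow)
        finally show ?thesis using b by (simp add: T_def field_simps)
      qed
      then have "(\<Sum>k | k < L \<and> n \<in> B k. b ^ k) \<le> T * (b / (b - 1))"
        using b by (intro geometric_sum_le_last) (auto simp: T_def)
      then have "(\<Sum>k | k < L \<and> n \<in> B k. b ^ k) * a\<^sup>2 \<le> T * (b / (b - 1)) * a\<^sup>2"
        by (intro mult_right_mono) auto
      also have "\<dots> = b * (b / (b - 1)) * (a powr (p - 2) * a powr 2)"
        using a by (simp add: T_def powr_numeral)
      also have "a powr (p - 2) * a powr 2 = a powr p" by (simp flip: powr_add)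
      finally show ?thesis by (simp add: a_def)
    qed
    have [measurable]: "?S X \<in> borel_measurable borel" for X by measurable
    have "(\<integral>\<^sup>+z. ennreal (cmod (?S A z) powr q) \<partial>circle_measure)
      \<le> (\<integral>\<^sup>+z. 1 + (\<Sum>k<L. ennreal (c * b ^ k) * ennreal ((cmod (?S (B k) z))\<^sup>2)) \<partial>circle_measure)"
    proof (rule nn_integral_mono_AE, use AE_circle in eventually_elim)
      case (elim z)
      have "ennreal (cmod (?S A z) powr q) \<le> ennreal (1 + (\<Sum>k<L. c * b ^ k * (cmod (?S (B k) z))\<^sup>2))"
        using pointwise[OF elim] by (rule ennreal_leI)
      also have "\<dots> = 1 + (\<Sum>k<L. ennreal (c * b ^ k) * ennreal ((cmod (?S (B k) z))\<^sup>2))"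
        using b by (simp add: ennreal_plus sum_nonneg c_def sum_ennreal[symmetric] ennreal_mult del: sum_ennreal)
      finally show ?case .
    qed
    also have "\<dots> = 1 + (\<Sum>k<L. ennreal (c * b ^ k) * ennreal (\<Sum>n\<in>B k. (cmod (f n))\<^sup>2))"
    proof -
      have [measurable_cong]: "sets circle_measure = sets borel" by (simp add: circle_measure_def)
      show ?thesis
        using parseval_trig[OF BA(2), of f]
        by (simp add: nn_integral_add nn_integral_sum nn_integral_cmult emeasure_space_circle)
    qed
    also have "\<dots> = ennreal (1 + (\<Sum>k<L. c * b ^ k * (\<Sum>n\<in>B k. (cmod (f n))\<^sup>2)))"
      using b by (simp add: ennreal_plus sum_nonneg c_def sum_ennreal[symmetric] ennreal_mult del: sum_ennreal)
    also have "(\<Sum>k<L. c * b ^ k * (\<Sum>n\<in>B k. (cmod (f n))\<^sup>2))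
      = c * (\<Sum>n\<in>A. (\<Sum>k | k < L \<and> n \<in> B k. b ^ k) * (cmod (f n))\<^sup>2)"
    proof -
      have "(\<Sum>k<L. c * b ^ k * (\<Sum>n\<in>B k. (cmod (f n))\<^sup>2))
        = c * (\<Sum>k<L. \<Sum>n | n \<in> A \<and> n \<in> B k. b ^ k * (cmod (f n))\<^sup>2)"
        using BA by (simp add: sum_distrib_left mult_ac Int_absorb1 Collect_conj_eq)
      also have "(\<Sum>k<L. \<Sum>n | n \<in> A \<and> n \<in> B k. b ^ k * (cmod (f n))\<^sup>2)
        = (\<Sum>n\<in>A. \<Sum>k | k \<in> {..<L} \<and> n \<in> B k. b ^ k * (cmod (f n))\<^sup>2)"
        using A by (intro sum.swap_restrict) auto
      finally show ?thesis by (simp add: sum_distrib_right)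
    qed
    also have "ennreal (1 + c * (\<Sum>n\<in>A. (\<Sum>k | k < L \<and> n \<in> B k. b ^ k) * (cmod (f n))\<^sup>2)) \<le> ennreal H"
    proof (rule ennreal_leI)
      have "(\<Sum>n\<in>A. (\<Sum>k | k < L \<and> n \<in> B k. b ^ k) * (cmod (f n))\<^sup>2)
        \<le> (\<Sum>n\<in>A. b * (b / (b - 1)) * cmod (f n) powr p)"
        by (intro sum_mono level)
      also have "\<dots> \<le> b * (b / (b - 1)) * 1"
        unfolding sum_distrib_left[symmetric] using b by (intro mult_left_mono mass) auto
      finally have "(\<Sum>n\<in>A. (\<Sum>k | k < L \<and> n \<in> B k. b ^ k) * (cmod (f n))\<^sup>2) \<le> b * (b / (b - 1))"
        by simp
      moreover have "0 \<le> c" by (simp add: c_def)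
      ultimately show "1 + c * (\<Sum>n\<in>A. (\<Sum>k | k < L \<and> n \<in> B k. b ^ k) * (cmod (f n))\<^sup>2) \<le> H"
        unfolding H_def by (intro add_left_mono mult_left_mono)
    qed
    finally show "(\<integral>\<^sup>+z. ennreal (cmod (?S A z) powr q) \<partial>circle_measure) \<le> ennreal H" .
  qed
qed

lemma hausdorff_young:
  fixes p q :: real
  assumes p: "1 < p" "p < 2" and q: "q = p / (p - 1)"
  obtains H where "0 \<le> H" and
    "\<And>f A. finite A \<Longrightarrow>
      (\<integral>\<^sup>+z. ennreal (cmod (\<Sum>n\<in>A. f n * z powi n) powr q) \<partial>circle_measure)
        \<le> ennreal (H * (\<Sum>n\<in>A. cmod (f n) powr p) powr (q / p))"
proof -
  obtain H where H: "0 \<le> H" and HY: "\<And>f A. finite A \<Longrightarrow> (\<Sum>n\<in>A. cmod (f n) powr p) \<le> 1 \<Longrightarrow>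
      (\<integral>\<^sup>+z. ennreal (cmod (\<Sum>n\<in>A. f n * z powi n) powr q) \<partial>circle_measure) \<le> ennreal H"
    using hausdorff_young_normalized[OF p q] by blast
  have q2: "q > 2" using p by (auto simp: q field_simps)
  show thesis
  proof (rule that[OF H])
    fix f :: "int \<Rightarrow> complex" and A :: "int set" assume A: "finite A"
    define m where "m = (\<Sum>n\<in>A. cmod (f n) powr p)"
    have "m \<ge> 0" by (simp add: m_def sum_nonneg)
    show "(\<integral>\<^sup>+z. ennreal (cmod (\<Sum>n\<in>A. f n * z powi n) powr q) \<partial>circle_measure)
        \<le> ennreal (H * m powr (q / p))"
    proof (cases "m = 0")
      case True
      then have "\<forall>n\<in>A. f n = 0" using A by (simp add: m_def sum_nonneg_eq_0_iff)
      then show ?thesis by simp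
    next
      case False
      then have m: "m > 0" using \<open>m \<ge> 0\<close> by simp
      define c where "c = m powr (1 / p)"
      have c: "c > 0" "c powr p = m" "c powr q = m powr (q / p)" using m p by (auto simp: c_def powr_powr)
      have "(\<Sum>n\<in>A. cmod (f n / of_real c) powr p) = (\<Sum>n\<in>A. cmod (f n) powr p / m)"
        using c by (simp add: norm_divide powr_divide)
      also have "\<dots> = 1" using m by (simp add: m_def flip: sum_divide_distrib)
      finally have "(\<integral>\<^sup>+z. ennreal (cmod (\<Sum>n\<in>A. f n / of_real c * z powi n) powr q) \<partial>circle_measure) \<le> ennreal H"
        using A by (intro HY) auto
      moreover have "cmod (\<Sum>n\<in>A. f n * z powi n) powr q
        = m powr (q / p) * cmod (\<Sum>n\<in>A. f n / of_real c * z powi n) powr q" for z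
      proof -
        have "(\<Sum>n\<in>A. f n * z powi n) = of_real c * (\<Sum>n\<in>A. f n / of_real c * z powi n)"
          using c by (simp add: sum_distrib_left)
        then have "cmod (\<Sum>n\<in>A. f n * z powi n) = c * cmod (\<Sum>n\<in>A. f n / of_real c * z powi n)"
          using c by (simp only: norm_mult) simp
        then show ?thesis using c by (simp add: powr_mult)
      qed
      moreover have [measurable_cong]: "sets circle_measure = sets borel" by (simp add: circle_measure_def)
      ultimately have "(\<integral>\<^sup>+z. ennreal (cmod (\<Sum>n\<in>A. f n * z powi n) powr q) \<partial>circle_measure)
        \<le> ennreal (m powr (q / p)) * ennreal H"
        by (simp add: ennreal_mult nn_integral_cmult mult_left_mono)
      then show ?thesis using H by (simp add: ennreal_mult mult.commute)
    qed
  qed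
qed

section \<open>A control for the linear sums\<close>

text \<open>A control, depending on the point \<open>z\<close> of the circle, for the sums of \<open>f\<close> over subintervals of
\<open>(s, t]\<close>. The two bounds are kept apart because of the recursive construction. A subinterval that shares an end
point with \<open>(s, t]\<close> leads to only one subinterval of the same kind when \<open>(s, t]\<close> is cut, so its bound loses only
a factor close to \<open>1\<close> at each level. A general subinterval is split in two by the first cut that meets it, and from then on
both parts are of the first kind: the factor \<open>3 powr \<rho>\<close> is lost only once.\<close>

definition tree_control ::
  "real \<Rightarrow> (int \<Rightarrow> complex) \<Rightarrow> int \<Rightarrow> int \<Rightarrow> (complex \<Rightarrow> int \<Rightarrow> int \<Rightarrow> real) \<Rightarrow> bool" where
  "tree_control \<rho> f s t w \<longleftrightarrow>
     (\<forall>z. control (w z) s t) \<and> (\<lambda>z. w z s t) \<in> borel_measurable borel \<and>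
     (\<forall>z M N. cmod z = 1 \<longrightarrow> s \<le> M \<longrightarrow> M \<le> N \<longrightarrow> N \<le> t \<longrightarrow> M = s \<or> N = t \<longrightarrow>
        cmod (trig_sum f M N z) powr \<rho> \<le> w z M N) \<and>
     (\<forall>z M N. cmod z = 1 \<longrightarrow> s \<le> M \<longrightarrow> M \<le> N \<longrightarrow> N \<le> t \<longrightarrow>
        cmod (trig_sum f M N z) powr \<rho> \<le> 3 powr \<rho> * w z M N)"

lemma measurable_trig_sum[measurable]: "trig_sum f M N \<in> borel_measurable borel"
  unfolding trig_sum_def[abs_def] by measurable

text \<open>The controls of both halves, multiplied by \<open>A\<close>, plus the \<open>\<rho>\<close>-th powers of the sums
over the left half, the cutting index and the right half, each counted for an interval that
contains the respective piece. The sum over a prefix that reaches beyond the cut consists of the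
full left half, the cutting index and a prefix of the right half; only the last one is estimated
recursively, at the price of the factor \<open>A\<close>. In the weight \<open>1 + C * 2 powr \<rho>\<close> the second summand
serves this estimate, while the \<open>1\<close> serves the intervals that reach into both halves.\<close>

lemma tree_control_join:
  assumes \<rho>: "1 \<le> \<rho>" and "s \<le> u" "u < t"
    and L: "tree_control \<rho> f s u wL" and R: "tree_control \<rho> f (u + 1) t wR"
    and A: "1 \<le> A" and C: "0 \<le> C" "\<And>x y. 0 \<le> x \<Longrightarrow> 0 \<le> y \<Longrightarrow> (x + y) powr \<rho> \<le> A * x powr \<rho> + C * y powr \<rho>"
  obtains w where "tree_control \<rho> f s t w"
    "\<And>z. w z s t = A * (wL z s u + wR z (u + 1) t)
       + (1 + C * 2 powr \<rho>) * (cmod (trig_sum f s u z) powr \<rho> + cmod (f (u + 1)) powr \<rho>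
           + cmod (trig_sum f (u + 1) t z) powr \<rho>)"
proof -
  define c where "c = 1 + C * 2 powr \<rho>"
  have c: "1 \<le> c" "C * 2 powr \<rho> \<le> c" using C by (auto simp: c_def)
  let ?x = "\<lambda>M N z. trig_sum f M N z"
  let ?n = "\<lambda>M N z. cmod (trig_sum f M N z) powr \<rho>"
  define w where "w z M N =
      A * (wL z (min M u) (min N u) + wR z (max M (u+1)) (max N (u+1)))
      + c * ((if M \<le> s \<and> u \<le> N then ?n s u z else 0)
        + (if M \<le> u \<and> u + 1 \<le> N then cmod (f (u+1)) powr \<rho> else 0)
        + (if M \<le> u + 1 \<and> t \<le> N then ?n (u+1) t z else 0))" for z M N
  have zero: "?n M M z = 0" for M z by (simp add: trig_sum_self)
  have cL: "control (wL z) s u" and cR: "control (wR z) (u+1) t" for z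
    using L R by (auto simp: tree_control_def)
  have cw: "control (w z) s t" for z
    unfolding w_def
    using assms(2,3) A c zero[of s] zero[of "u+1"]
    by (intro control_add control_scale control_restrict_left control_restrict_right control_indicator cL cR)
       (force intro: less_le[THEN iffD2])+
  have wst: "w z s t = A * (wL z s u + wR z (u + 1) t) + c * (?n s u z + cmod (f (u + 1)) powr \<rho> + ?n (u + 1) t z)"
    for z using assms(2,3) by (simp add: w_def)
  have nn: "0 \<le> wL z (min M u) (min N u)" "0 \<le> wR z (max M (u+1)) (max N (u+1))"
    if "s \<le> M" "M \<le> N" "N \<le> t" for z M N
    using that assms(2,3) by (auto intro!: control_nonneg[OF cL] control_nonneg[OF cR])
  have ge: "A * (wL z (min M u) (min N u) + wR z (max M (u+1)) (max N (u+1)))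
     + (if M \<le> u \<and> u + 1 \<le> N then cmod (f (u+1)) powr \<rho> else 0) \<le> w z M N" for z M N
    unfolding w_def using c by (intro add_left_mono) (auto intro!: order_trans[OF _ mult_right_mono[of 1 c]])
  have ge': "wL z (min M u) (min N u) + wR z (max M (u+1)) (max N (u+1))
     + (if M \<le> u \<and> u + 1 \<le> N then cmod (f (u+1)) powr \<rho> else 0) \<le> w z M N"
    if "s \<le> M" "M \<le> N" "N \<le> t" for z M N
    using ge[of z M N] nn[OF that, of z] mult_right_mono[OF A, of "wL z (min M u) (min N u) + wR z (max M (u+1)) (max N (u+1))"]
    by auto
  have L1: "?n M N z \<le> wL z M N" if "cmod z = 1" "s \<le> M" "M \<le> N" "N \<le> u" "M = s \<or> N = u" for z M N
    using L that by (auto simp: tree_control_def)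
  have R1: "?n M N z \<le> wR z M N" if "cmod z = 1" "u+1 \<le> M" "M \<le> N" "N \<le> t" "M = u+1 \<or> N = t" for z M N
    using R that by (auto simp: tree_control_def)
  have L2: "?n M N z \<le> 3 powr \<rho> * wL z M N" if "cmod z = 1" "s \<le> M" "M \<le> N" "N \<le> u" for z M N
    using L that by (auto simp: tree_control_def)
  have R2: "?n M N z \<le> 3 powr \<rho> * wR z M N" if "cmod z = 1" "u+1 \<le> M" "M \<le> N" "N \<le> t" for z M N
    using R that by (auto simp: tree_control_def)
  have split: "?x M N z = ?x M u z + f (u+1) * z powi (u+1) + ?x (u+1) N z" if "M \<le> u" "u + 1 \<le> N" for M N z
    using that trig_sum_append[of M "u+1" N f z] trig_sum_append[of M u "u+1" f z]
    by (simp add: trig_sum_single)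
  have two: "C * (cmod a + cmod b) powr \<rho> \<le> c * (cmod a powr \<rho> + cmod b powr \<rho>)" for a b
  proof -
    have "C * (cmod a + cmod b) powr \<rho> \<le> C * (2 powr \<rho> * (cmod a powr \<rho> + cmod b powr \<rho>))"
      using C \<rho> by (intro mult_left_mono powr_add_le) auto
    also have "\<dots> = (C * 2 powr \<rho>) * (cmod a powr \<rho> + cmod b powr \<rho>)" by simp
    also have "\<dots> \<le> c * (cmod a powr \<rho> + cmod b powr \<rho>)" by (intro mult_right_mono c) auto
    finally show ?thesis .
  qed
  have peel: "cmod (a + b + d) powr \<rho> \<le> A * cmod a powr \<rho> + c * (cmod b powr \<rho> + cmod d powr \<rho>)" for a b d
  proof -
    have "cmod (a + b + d) \<le> cmod a + (cmod b + cmod d)"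
      using norm_triangle_ineq[of "a + b" d] norm_triangle_ineq[of a b] by linarith
    then have "cmod (a + b + d) powr \<rho> \<le> (cmod a + (cmod b + cmod d)) powr \<rho>"
      using \<rho> by (intro powr_mono2) auto
    also have "\<dots> \<le> A * cmod a powr \<rho> + C * (cmod b + cmod d) powr \<rho>" by (intro C) auto
    finally show ?thesis using two[of b d] by linarith
  qed
  have one: "?n M N z \<le> w z M N"
    if z: "cmod z = 1" and MN: "s \<le> M" "M \<le> N" "N \<le> t" "M = s \<or> N = t" for z M N
  proof -
    consider "N \<le> u" | "u + 1 \<le> M" | "M \<le> u" "u + 1 \<le> N" by linarith
    then show ?thesis
    proof cases
      case 1
      then have "M = s \<or> N = u" using MN assms(3) by auto
      then show ?thesis using L1[OF z, of M N] ge'[OF MN(1-3), of z] nn[OF MN(1-3), of z] 1 MN by simp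
    next
      case 2
      then have "M = u+1 \<or> N = t" using MN assms(2) by auto
      then show ?thesis using R1[OF z, of M N] ge'[OF MN(1-3), of z] nn[OF MN(1-3), of z] 2 MN by simp
    next
      case 3
      have fz: "cmod (f (u+1) * z powi (u+1)) = cmod (f (u+1))"
        by (simp add: norm_mult norm_power_int_unit z)
      show ?thesis
      proof (cases "N = t")
        case True
        have "?n M N z \<le> A * ?n M u z + c * (cmod (f (u+1)) powr \<rho> + ?n (u+1) t z)"
          using peel[of "?x M u z" "f (u+1) * z powi (u+1)" "?x (u+1) t z"] split[OF 3, of z] True fz by simp
        also have "A * ?n M u z \<le> A * wL z M u" using A 3 MN by (intro mult_left_mono L1 z) auto
        finally have "?n M N z \<le> A * (wL z M u + 0) + c * (0 + cmod (f (u+1)) powr \<rho> + ?n (u+1) t z)" by simp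
        also have "\<dots> \<le> w z M N"
          unfolding w_def using 3 MN True A c nn[OF MN(1-3), of z]
          by (intro add_mono mult_left_mono) auto
        finally show ?thesis .
      next
        case False
        then have s: "M = s" using MN by simp
        have "?n M N z \<le> A * ?n (u+1) N z + c * (?n s u z + cmod (f (u+1)) powr \<rho>)"
          using peel[of "?x (u+1) N z" "?x s u z" "f (u+1) * z powi (u+1)"] split[OF 3, of z] s fz
          by (simp add: add_ac)
        also have "A * ?n (u+1) N z \<le> A * wR z (u+1) N" using A 3 MN by (intro mult_left_mono R1 z) auto
        finally have "?n M N z \<le> A * (0 + wR z (u+1) N) + c * (?n s u z + cmod (f (u+1)) powr \<rho> + 0)" by simp
        also have "\<dots> \<le> w z M N"
          unfolding w_def using 3 MN s A c nn[OF MN(1-3), of z]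
          by (intro add_mono mult_left_mono) auto
        finally show ?thesis .
      qed
    qed
  qed
  have all: "?n M N z \<le> 3 powr \<rho> * w z M N"
    if z: "cmod z = 1" and MN: "s \<le> M" "M \<le> N" "N \<le> t" for z M N
  proof -
    consider "N \<le> u" | "u + 1 \<le> M" | "M \<le> u" "u + 1 \<le> N" by linarith
    then show ?thesis
    proof cases
      case 1
      have "?n M N z \<le> 3 powr \<rho> * wL z M N" using 1 MN by (intro L2 z) auto
      also have "\<dots> \<le> 3 powr \<rho> * w z M N"
        using ge'[OF MN, of z] nn[OF MN, of z] 1 MN by (intro mult_left_mono) auto
      finally show ?thesis .
    next
      case 2
      have "?n M N z \<le> 3 powr \<rho> * wR z M N" using 2 MN by (intro R2 z) auto
      also have "\<dots> \<le> 3 powr \<rho> * w z M N"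
        using ge'[OF MN, of z] nn[OF MN, of z] 2 MN by (intro mult_left_mono) auto
      finally show ?thesis .
    next
      case 3
      have fz: "cmod (f (u+1) * z powi (u+1)) = cmod (f (u+1))"
        by (simp add: norm_mult norm_power_int_unit z)
      have "cmod (?x M N z) \<le> cmod (?x M u z) + cmod (f (u+1)) + cmod (?x (u+1) N z)"
        unfolding split[OF 3, of z] fz[symmetric]
        by (intro order_trans[OF norm_triangle_ineq] add_right_mono norm_triangle_ineq)
      then have "?n M N z \<le> (cmod (?x M u z) + cmod (f (u+1)) + cmod (?x (u+1) N z)) powr \<rho>"
        using \<rho> by (intro powr_mono2) auto
      also have "\<dots> \<le> 3 powr \<rho> * (?n M u z + cmod (f (u+1)) powr \<rho> + ?n (u+1) N z)"
        using \<rho> by (intro powr_add3_le) auto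
      also have "\<dots> \<le> 3 powr \<rho> * w z M N"
        using L1[OF z, of M u] R1[OF z, of "u+1" N] ge'[OF MN, of z] 3 MN by (intro mult_left_mono) auto
      finally show ?thesis .
    qed
  qed
  have meas: "(\<lambda>z. w z s t) \<in> borel_measurable borel"
  proof -
    have [measurable]: "(\<lambda>z. wL z s u) \<in> borel_measurable borel" "(\<lambda>z. wR z (u+1) t) \<in> borel_measurable borel"
      using L R by (auto simp: tree_control_def)
    show ?thesis unfolding wst by measurable
  qed
  show thesis
    by (rule that[of w]) (use cw one all meas wst in \<open>auto simp: tree_control_def c_def\<close>)
qed

text \<open>Apply \<open>tree_control_join\<close> recursively, each time at the median of the mass. With \<open>\<sigma> = q/\<rho>\<close>, merging the
halves costs \<open>A powr (1 + \<sigma>) * 2 powr (\<sigma> - 1)\<close>, there are two of them, and halving the mass gains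
\<open>2 powr (- q/p)\<close>. The product of these numbers is \<open>\<theta> = A powr (1 + \<sigma>) * \<gamma>\<close> with
\<open>\<gamma> = 2 powr (\<sigma> - q/p) < 1\<close> because \<open>\<rho> > p\<close>, and \<open>A > 1\<close> is chosen to make \<open>\<theta>\<close> the
square root of \<open>\<gamma>\<close>. The Hausdorff--Young inequality adds \<open>D\<close> times the power of the mass at each
step, and \<open>B\<close> solves \<open>\<theta> * B + D = B\<close>.\<close>

lemma tree_control_exists:
  fixes p \<rho> q :: real
  assumes p: "1 < p" "p < \<rho>" "\<rho> < 2" and q: "q = p / (p - 1)"
  obtains B where "0 \<le> B" and
    "\<And>f s t. s \<le> t \<Longrightarrow> \<exists>w. tree_control \<rho> f s t w \<and>
      (\<integral>\<^sup>+z. ennreal (w z s t powr (q / \<rho>)) \<partial>circle_measure) \<le> ennreal (B * mass p f s t powr (q / p))"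
proof -
  have q2: "q > 2" using p by (auto simp: q field_simps)
  define \<sigma> where "\<sigma> = q / \<rho>"
  have \<sigma>: "\<sigma> > 1" "\<rho> * \<sigma> = q" using p q2 by (auto simp: \<sigma>_def field_simps)
  obtain H where H: "0 \<le> H" and HY: "\<And>f A. finite A \<Longrightarrow>
      (\<integral>\<^sup>+z. ennreal (cmod (\<Sum>n\<in>A. f n * z powi n) powr q) \<partial>circle_measure)
        \<le> ennreal (H * (\<Sum>n\<in>A. cmod (f n) powr p) powr (q / p))"
    using hausdorff_young[of p q] p q by auto
  define \<gamma> where "\<gamma> = (2::real) powr (\<sigma> - q / p)"
  have "\<sigma> < q / p" using p q2 by (simp add: \<sigma>_def divide_strict_left_mono)
  then have \<gamma>: "0 < \<gamma>" "\<gamma> < 1" using powr_less_mono[of "\<sigma> - q / p" 0 2] by (auto simp: \<gamma>_def)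
  define A where "A = \<gamma> powr (- 1 / (2 * (1 + \<sigma>)))"
  have A: "A > 1"
    using \<gamma> \<sigma> powr_less_mono'[of \<gamma> "- 1 / (2 * (1 + \<sigma>))" 0] by (simp add: A_def)
  define \<theta> where "\<theta> = A powr (1 + \<sigma>) * \<gamma>"
  have "\<theta> = \<gamma> powr (1 / 2)"
  proof -
    have "\<theta> = \<gamma> powr (- 1 / (2 * (1 + \<sigma>)) * (1 + \<sigma>)) * \<gamma> powr 1"
      using \<gamma> by (simp add: \<theta>_def A_def powr_powr)
    also have "\<dots> = \<gamma> powr (- 1 / (2 * (1 + \<sigma>)) * (1 + \<sigma>) + 1)" by (simp only: powr_add)
    also have "- 1 / (2 * (1 + \<sigma>)) * (1 + \<sigma>) + 1 = 1 / 2" using \<sigma> by (simp add: field_simps)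
    finally show ?thesis .
  qed
  then have \<theta>: "0 \<le> \<theta>" "\<theta> < 1" using \<gamma> powr_less_mono2[of "1/2" \<gamma> 1] by auto
  obtain C where C: "0 \<le> C" "\<And>x y. 0 \<le> x \<Longrightarrow> 0 \<le> y \<Longrightarrow> (x + y) powr \<rho> \<le> A * x powr \<rho> + C * y powr \<rho>"
    using powr_add_le_eps[OF A, of \<rho>] p by auto
  obtain C' where C': "0 \<le> C'" "\<And>x y. 0 \<le> x \<Longrightarrow> 0 \<le> y \<Longrightarrow> (x + y) powr \<sigma> \<le> A * x powr \<sigma> + C' * y powr \<sigma>"
    using powr_add_le_eps[OF A, of \<sigma>] \<sigma> by auto
  define c where "c = 1 + C * 2 powr \<rho>"
  have c: "1 \<le> c" using C by (simp add: c_def)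
  define D where "D = C' * (c powr \<sigma> * 3 powr \<sigma>) * (2 * H + 1)"
  have D: "0 \<le> D" using C' H by (simp add: D_def)
  define B where "B = D / (1 - \<theta>)"
  have B: "0 \<le> B" "\<theta> * B + D = B" using D \<theta> by (auto simp: B_def field_simps)
  have [measurable_cong]: "sets circle_measure = sets borel" by (simp add: circle_measure_def)
  show thesis
  proof (rule that[OF B(1)], unfold \<sigma>_def[symmetric])
    fix f :: "int \<Rightarrow> complex" and s t :: int
    assume "s \<le> t"
    then show "\<exists>w. tree_control \<rho> f s t w \<and>
      (\<integral>\<^sup>+z. ennreal (w z s t powr \<sigma>) \<partial>circle_measure) \<le> ennreal (B * mass p f s t powr (q / p))"
    proof (induction "nat (t - s)" arbitrary: s t rule: less_induct)
      case (less s t)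
      show ?case
      proof (cases "s = t")
        case True
        have "tree_control \<rho> f s t (\<lambda>_ _ _. 0)"
          using True p by (auto simp: tree_control_def control_def trig_sum_def)
        then show ?thesis by (intro exI[of _ "\<lambda>_ _ _. 0"]) auto
      next
        case False
        then have "s < t" using less.prems by simp
        let ?m = "mass p f"
        obtain u where u: "s \<le> u" "u < t" "?m s u \<le> ?m s t / 2" "?m (u+1) t \<le> ?m s t / 2"
          using control_median[OF control_mass \<open>s < t\<close>] by blast
        obtain wL where L: "tree_control \<rho> f s u wL"
          "(\<integral>\<^sup>+z. ennreal (wL z s u powr \<sigma>) \<partial>circle_measure) \<le> ennreal (B * ?m s u powr (q / p))"
          using less.hyps[of u s] u by auto
        obtain wR where R: "tree_control \<rho> f (u+1) t wR"
          "(\<integral>\<^sup>+z. ennreal (wR z (u+1) t powr \<sigma>) \<partial>circle_measure) \<le> ennreal (B * ?m (u+1) t powr (q / p))"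
          using less.hyps[of t "u+1"] u by auto
        obtain w where w: "tree_control \<rho> f s t w"
          "\<And>z. w z s t = A * (wL z s u + wR z (u + 1) t)
             + c * (cmod (trig_sum f s u z) powr \<rho> + cmod (f (u + 1)) powr \<rho>
                 + cmod (trig_sum f (u + 1) t z) powr \<rho>)"
          using tree_control_join[OF _ u(1,2) L(1) R(1) _ C] p A unfolding c_def by auto
        have [measurable]: "(\<lambda>z. wL z s u) \<in> borel_measurable borel" "(\<lambda>z. wR z (u+1) t) \<in> borel_measurable borel"
          using L R by (auto simp: tree_control_def)
        define T where "T = ?m s t powr (q / p)"
        have T: "0 \<le> T" by (simp add: T_def)
        define E where "E = A powr (1 + \<sigma>) * 2 powr (\<sigma> - 1)"
        define G where "G = C' * (c powr \<sigma> * 3 powr \<sigma>)"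
        have EG: "0 \<le> E" "0 \<le> G" using C' by (auto simp: E_def G_def)
        let ?g = "\<lambda>z. cmod (trig_sum f s u z) powr q + cmod (f (u + 1)) powr q + cmod (trig_sum f (u + 1) t z) powr q"
        have pointwise: "w z s t powr \<sigma> \<le> E * (wL z s u powr \<sigma> + wR z (u+1) t powr \<sigma>) + G * ?g z" for z
        proof -
          define X where "X = wL z s u"
          define Y where "Y = wR z (u+1) t"
          have XY: "0 \<le> X" "0 \<le> Y"
            using L(1) R(1) u unfolding tree_control_def X_def Y_def
            by (auto intro!: control_nonneg[of "wL z" s u] control_nonneg[of "wR z" "u+1" t])
          define g where "g = cmod (trig_sum f s u z) powr \<rho> + cmod (f (u + 1)) powr \<rho>
                 + cmod (trig_sum f (u + 1) t z) powr \<rho>"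
          have g: "0 \<le> g" by (simp add: g_def)
          have "w z s t powr \<sigma> = (A * (X + Y) + c * g) powr \<sigma>" by (simp add: w(2) X_def Y_def g_def)
          also have "\<dots> \<le> A * (A * (X + Y)) powr \<sigma> + C' * (c * g) powr \<sigma>"
            using XY g c A by (intro C') auto
          also have "A * (A * (X + Y)) powr \<sigma> = A powr (1 + \<sigma>) * (X + Y) powr \<sigma>"
            using A XY by (simp add: powr_mult powr_add)
          also have "\<dots> \<le> A powr (1 + \<sigma>) * (2 powr (\<sigma> - 1) * (X powr \<sigma> + Y powr \<sigma>))"
            using XY \<sigma> by (intro mult_left_mono powr_add_le_convex) auto
          also have "C' * (c * g) powr \<sigma> = C' * (c powr \<sigma> * g powr \<sigma>)"
            using c g by (simp add: powr_mult)
          also have "\<dots> \<le> C' * (c powr \<sigma> * (3 powr \<sigma> * ?g z))"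
          proof -
            have "g powr \<sigma> \<le> 3 powr \<sigma> * ((cmod (trig_sum f s u z) powr \<rho>) powr \<sigma> + (cmod (f (u + 1)) powr \<rho>) powr \<sigma>
                 + (cmod (trig_sum f (u + 1) t z) powr \<rho>) powr \<sigma>)"
              unfolding g_def using \<sigma> by (intro powr_add3_le) auto
            then show ?thesis using \<sigma> C' by (intro mult_left_mono) (auto simp: powr_powr)
          qed
          finally show ?thesis by (simp add: E_def G_def X_def Y_def mult_ac)
        qed
        have half: "x powr (q / p) \<le> 2 powr (- (q / p)) * T" if "x \<le> ?m s t / 2" "0 \<le> x" for x
        proof -
          have "x powr (q / p) \<le> (?m s t / 2) powr (q / p)" using that q2 p by (intro powr_mono2) auto
          then show ?thesis by (simp add: half_powr mass_nonneg T_def)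
        qed
        have le_T: "x powr (q / p) \<le> T" if "x \<le> ?m s t" "0 \<le> x" for x
          unfolding T_def using that q2 p by (intro powr_mono2) auto
        have intS: "(\<integral>\<^sup>+z. ennreal (cmod (trig_sum f M N z) powr q) \<partial>circle_measure) \<le> ennreal (H * T)"
          if "s \<le> M" "M \<le> N" "N \<le> t" for M N
        proof -
          have "(\<integral>\<^sup>+z. ennreal (cmod (trig_sum f M N z) powr q) \<partial>circle_measure) \<le> ennreal (H * ?m M N powr (q / p))"
            using HY[of "{M+1..N}" f] by (simp add: trig_sum_def mass_def)
          also have "\<dots> \<le> ennreal (H * T)"
            using that H by (intro ennreal_leI mult_left_mono le_T control_mono[OF control_mass] mass_nonneg) auto
          finally show ?thesis .
        qed
        have f_T: "cmod (f (u+1)) powr q \<le> T"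
        proof -
          have "cmod (f (u+1)) powr q = ?m u (u+1) powr (q / p)"
            using p by (simp add: mass_def powr_powr)
          also have "\<dots> \<le> T" using u by (intro le_T control_mono[OF control_mass] mass_nonneg) auto
          finally show ?thesis .
        qed
        have "(\<integral>\<^sup>+z. ennreal (w z s t powr \<sigma>) \<partial>circle_measure)
          \<le> (\<integral>\<^sup>+z. ennreal E * (ennreal (wL z s u powr \<sigma>) + ennreal (wR z (u+1) t powr \<sigma>))
              + ennreal G * (ennreal (cmod (trig_sum f s u z) powr q) + ennreal (cmod (f (u + 1)) powr q)
                  + ennreal (cmod (trig_sum f (u + 1) t z) powr q)) \<partial>circle_measure)"
          using EG by (intro nn_integral_mono order_trans[OF ennreal_leI[OF pointwise]])
            (simp add: ennreal_mult ennreal_plus)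
        also have "\<dots> = ennreal E * ((\<integral>\<^sup>+z. ennreal (wL z s u powr \<sigma>) \<partial>circle_measure)
              + (\<integral>\<^sup>+z. ennreal (wR z (u+1) t powr \<sigma>) \<partial>circle_measure))
            + ennreal G * ((\<integral>\<^sup>+z. ennreal (cmod (trig_sum f s u z) powr q) \<partial>circle_measure)
              + ennreal (cmod (f (u + 1)) powr q)
              + (\<integral>\<^sup>+z. ennreal (cmod (trig_sum f (u + 1) t z) powr q) \<partial>circle_measure))"
          by (simp add: nn_integral_add nn_integral_cmult emeasure_space_circle)
        also have "\<dots> \<le> ennreal E * (ennreal (B * (2 powr (- (q / p)) * T)) + ennreal (B * (2 powr (- (q / p)) * T)))
            + ennreal G * (ennreal (H * T) + ennreal T + ennreal (H * T))"
          using u B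
          by (intro add_mono mult_left_mono intS ennreal_leI f_T order_trans[OF L(2)] order_trans[OF R(2)] half mass_nonneg) auto
        also have "\<dots> = ennreal (E * (B * (2 powr (- (q / p)) * T) + B * (2 powr (- (q / p)) * T))
            + G * (H * T + T + H * T))"
          using EG B(1) H T
          by (simp only: ennreal_mult ennreal_plus mult_nonneg_nonneg add_nonneg_nonneg powr_ge_zero)
        also have "E * (B * (2 powr (- (q / p)) * T) + B * (2 powr (- (q / p)) * T)) + G * (H * T + T + H * T)
          = (E * 2 * 2 powr (- (q / p)) * B + G * (2 * H + 1)) * T"
          by (simp add: algebra_simps)
        also have "E * 2 * 2 powr (- (q / p)) = \<theta>"
          by (simp add: E_def \<theta>_def \<gamma>_def powr_diff powr_minus_divide)
        also have "\<theta> * B + G * (2 * H + 1) = B" using B(2) by (simp add: D_def G_def)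
        finally show ?thesis using w(1) by (auto simp: T_def)
      qed
    qed
  qed
qed

section \<open>The variation on finite windows\<close>

text \<open>The operator norm is the norm of the bounded operator that depends linearly on the matrix.\<close>

lemma continuous_on_opn: "continuous_on UNIV opn"
proof -
  have blin: "blinfun_apply (Blinfun ((*v) X)) = (*v) X" for X :: "complex^2^2"
    by (rule bounded_linear_Blinfun_apply[OF matrix_vector_mul_bounded_linear])
  have "linear (\<lambda>X :: complex^2^2. Blinfun ((*v) X))"
  proof
    fix X Y :: "complex^2^2" and c :: real
    show "Blinfun ((*v) (X + Y)) = Blinfun ((*v) X) + Blinfun ((*v) Y)"
      by (rule blinfun_eqI) (simp add: blin blinfun.add_left matrix_vector_mult_add_rdistrib)
    show "Blinfun ((*v) (c *\<^sub>R X)) = c *\<^sub>R Blinfun ((*v) X)"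
      by (rule blinfun_eqI)
        (simp add: blin blinfun.scaleR_left vec_eq_iff matrix_vector_mult_def sum_2 algebra_simps)
  qed
  then have "continuous_on UNIV (\<lambda>X :: complex^2^2. norm (Blinfun ((*v) X)))"
    by (intro continuous_on_norm linear_continuous_on) (simp add: linear_conv_bounded_linear)
  moreover have "norm (Blinfun ((*v) X)) = opn X" for X :: "complex^2^2"
    by (simp add: norm_blinfun.rep_eq blin opn_def)
  ultimately show ?thesis by simp
qed

lemma continuous_on_entries:
  fixes X :: "'a::topological_space \<Rightarrow> complex^2^2"
  assumes "\<And>i j. continuous_on S (\<lambda>z. X z $ i $ j)"
  shows "continuous_on S X"
proof -
  have "continuous_on S (\<lambda>z. \<chi> i j. X z $ i $ j)"
    by (intro continuous_on_vec_lambda assms)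
  then show ?thesis by simp
qed

lemma continuous_on_transfer: "continuous_on (- {0}) (transfer F n)"
proof (rule continuous_on_entries)
  fix i j :: 2
  show "continuous_on (- {0}) (\<lambda>z. transfer F n z $ i $ j)"
    unfolding transfer_def
    using exhaust_2[of i] exhaust_2[of j]
    by (elim disjE; simp; intro continuous_intros; simp)
qed

lemma continuous_on_matrix_mult:
  fixes X Y :: "'a::topological_space \<Rightarrow> complex^2^2"
  assumes "continuous_on S X" "continuous_on S Y"
  shows "continuous_on S (\<lambda>z. X z ** Y z)"
  unfolding matrix_matrix_mult_def by (intro continuous_intros assms)

lemma continuous_on_transfer_prod: "continuous_on (- {0}) (transfer_prod F M N)"
proof -
  have "continuous_on (- {0}) (\<lambda>z. foldr (**) (map (\<lambda>n. transfer F n z) ns) (mat 1))" for ns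
    by (induction ns) (simp_all add: continuous_on_matrix_mult continuous_on_transfer)
  then show ?thesis by (simp add: transfer_prod_def[abs_def])
qed

lemma measurable_nlft_dist[measurable]: "nlft_dist F M N \<in> borel_measurable borel"
proof (rule borel_measurable_continuous_countable_exceptions[of "{0}"])
  have "continuous_on (- {0}) (\<lambda>z. opn (transfer_prod F M N z - mat 1))"
    by (rule continuous_on_compose2[OF continuous_on_opn])
       (auto intro!: continuous_intros continuous_on_transfer_prod)
  moreover have "1 + opn X \<noteq> 0" for X using opn_nonneg[of X] by linarith
  ultimately show "continuous_on (- {0}) (nlft_dist F M N)"
    unfolding nlft_dist_eq_opn[abs_def] by (auto intro!: continuous_intros)
qed simp

text \<open>For an interval \<open>I\<close> the bound by a control applies, and the full variation is the increasing limit
of those for the windows \<open>{- int L..int L}\<close>.\<close>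

definition variation_within :: "int set \<Rightarrow> real \<Rightarrow> (int \<Rightarrow> complex) \<Rightarrow> complex \<Rightarrow> ennreal" where
  "variation_within I r F z =
     (SUP K\<in>{1::nat..}. SUP N\<in>{N. strict_mono_on {0..K} N \<and> N ` {0..K} \<subseteq> I}.
        ennreal ((\<Sum>j<K. nlft_dist F (N j) (N (Suc j)) z powr r) powr (1/r)))"

lemma nlft_variation_eq_within: "nlft_variation r F z = variation_within UNIV r F z"
  by (simp add: nlft_variation_def variation_within_def)

lemma variation_within_mono: "I \<subseteq> J \<Longrightarrow> variation_within I r F z \<le> variation_within J r F z"
  unfolding variation_within_def by (intro SUP_subset_mono order_refl) auto

lemma nlft_variation_eq_SUP:
  "nlft_variation r F z = (SUP L::nat. variation_within {- int L..int L} r F z)"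
proof (rule antisym)
  show "(SUP L::nat. variation_within {- int L..int L} r F z) \<le> nlft_variation r F z"
    unfolding nlft_variation_eq_within by (intro SUP_least variation_within_mono) auto
  show "nlft_variation r F z \<le> (SUP L::nat. variation_within {- int L..int L} r F z)"
    unfolding nlft_variation_def
  proof (intro SUP_least)
    fix K :: nat and N :: "nat \<Rightarrow> int"
    assume K: "K \<in> {1..}" and N: "N \<in> {N. strict_mono_on {0..K} N}"
    \<comment> \<open>The sum is a convenient common bound for the finitely many values.\<close>
    define L where "L = (\<Sum>j\<in>{0..K}. nat \<bar>N j\<bar>)"
    have "nat \<bar>N j\<bar> \<le> L" if "j \<in> {0..K}" for j
      unfolding L_def using that by (intro member_le_sum) auto
    then have "N ` {0..K} \<subseteq> {- int L..int L}" by fastforce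
    then have "ennreal ((\<Sum>j<K. nlft_dist F (N j) (N (Suc j)) z powr r) powr (1/r))
      \<le> variation_within {- int L..int L} r F z"
      unfolding variation_within_def using K N
      by (intro SUP_upper2[of K] SUP_upper2[of N]) auto
    then show "ennreal ((\<Sum>j<K. nlft_dist F (N j) (N (Suc j)) z powr r) powr (1/r))
      \<le> (SUP L::nat. variation_within {- int L..int L} r F z)"
      by (intro SUP_upper2[of L]) auto
  qed
qed

text \<open>The index set of the supremum is uncountable, but a term depends only on the values of \<open>N\<close> on
\<open>{0..K}\<close>, and there are countably many such restrictions.\<close>

lemma measurable_variation_within[measurable]: "variation_within I r F \<in> borel_measurable borel"
proof -
  have *: "(\<lambda>z. SUP N\<in>{N. strict_mono_on {0..K} N \<and> N ` {0..K} \<subseteq> I}.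
      ennreal ((\<Sum>j<K. nlft_dist F (N j) (N (Suc j)) z powr r) powr (1/r))) \<in> borel_measurable borel"
    (is "(\<lambda>z. SUP N\<in>?X. ?g z N) \<in> _") for K
  proof -
    let ?res = "\<lambda>N. restrict N {0..K} :: nat \<Rightarrow> int"
    have g: "?g z (?res N) = ?g z N" for z N by (intro arg_cong[where f = ennreal] arg_cong2[where f = "(powr)"] sum.cong) auto
    have "countable (?res ` ?X)"
      by (rule countable_subset[OF _ countable_PiE[of "{0..K}" "\<lambda>_. UNIV"]]) auto
    then have "(\<lambda>z. SUP N\<in>?res ` ?X. ?g z N) \<in> borel_measurable borel"
      by measurable
    also have "(\<lambda>z. SUP N\<in>?res ` ?X. ?g z N) = (\<lambda>z. SUP N\<in>?X. ?g z N)"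
      unfolding image_image g ..
    finally show ?thesis .
  qed
  show ?thesis
    unfolding variation_within_def[abs_def] by (rule borel_measurable_SUP) (simp, rule *)
qed

lemma measurable_nlft_variation[measurable]: "nlft_variation r F \<in> borel_measurable borel"
  unfolding nlft_variation_eq_SUP[abs_def] by measurable

lemma variation_within_antimono_exponent:
  assumes "0 < \<rho>" "\<rho> \<le> r"
  shows "variation_within I r F z \<le> variation_within I \<rho> F z"
proof -
  have le: "(\<Sum>j<K. a j powr r) powr (1/r) \<le> (\<Sum>j<K. a j powr \<rho>) powr (1/\<rho>)"
    if "\<And>j. 0 \<le> a j" for a :: "nat \<Rightarrow> real" and K
  proof -
    have "(\<Sum>j<K. a j powr r) = (\<Sum>j<K. (a j powr \<rho>) powr (r / \<rho>))"
      using assms by (simp add: powr_powr)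
    also have "\<dots> \<le> (\<Sum>j<K. a j powr \<rho>) powr (r / \<rho>)"
      using assms by (intro sum_powr_le) auto
    finally have "(\<Sum>j<K. a j powr r) powr (1/r) \<le> ((\<Sum>j<K. a j powr \<rho>) powr (r / \<rho>)) powr (1/r)"
      using assms by (intro powr_mono2 sum_nonneg) auto
    then show ?thesis using assms by (simp add: powr_powr)
  qed
  show ?thesis
    unfolding variation_within_def
    by (intro SUP_subset_mono order_refl ennreal_leI le nlft_dist_nonneg)
qed

lemma measurable_small_variation_set[measurable]: "small_variation_set p r F \<in> sets borel"
proof -
  have "unit_circle \<in> sets borel" by (simp add: unit_circle_def)
  then show ?thesis
    unfolding small_variation_set_def by measurable
qed

section \<open>Powers of extended reals and norms\<close>

lemma ennreal_rpow_ennreal: "0 \<le> x \<Longrightarrow> ennreal_rpow (ennreal x) q = ennreal (x powr q)"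
  by (simp add: ennreal_rpow_def)

lemma ennreal_rpow_0: "ennreal_rpow 0 q = 0"
  by (simp add: ennreal_rpow_def)

lemma ennreal_rpow_mono: "0 \<le> q \<Longrightarrow> x \<le> y \<Longrightarrow> ennreal_rpow x q \<le> ennreal_rpow y q"
  by (cases x; cases y) (auto simp: ennreal_rpow_def top_unique intro!: ennreal_leI powr_mono2)

lemma ennreal_rpow_inverse: "0 < q \<Longrightarrow> ennreal_rpow (ennreal_rpow x q) (1 / q) = x"
  "0 < q \<Longrightarrow> ennreal_rpow (ennreal_rpow x (1 / q)) q = x"
  by (cases x; simp add: ennreal_rpow_def powr_powr)+

text \<open>Powers are order isomorphisms, the inverse being the power with the reciprocal exponent.\<close>

lemma ennreal_rpow_SUP:
  assumes "0 < q"
  shows "ennreal_rpow (SUP i\<in>I. f i) q = (SUP i\<in>I. ennreal_rpow (f i) q)"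
proof (rule antisym)
  have "f i \<le> ennreal_rpow (SUP i\<in>I. ennreal_rpow (f i) q) (1 / q)" if "i \<in> I" for i
    using ennreal_rpow_mono[of "1 / q", OF _ SUP_upper[OF that, of "\<lambda>i. ennreal_rpow (f i) q"]] assms
    by (simp add: ennreal_rpow_inverse)
  then have "(SUP i\<in>I. f i) \<le> ennreal_rpow (SUP i\<in>I. ennreal_rpow (f i) q) (1 / q)"
    by (intro SUP_least)
  then have "ennreal_rpow (SUP i\<in>I. f i) q
      \<le> ennreal_rpow (ennreal_rpow (SUP i\<in>I. ennreal_rpow (f i) q) (1 / q)) q"
    using assms by (intro ennreal_rpow_mono) auto
  then show "ennreal_rpow (SUP i\<in>I. f i) q \<le> (SUP i\<in>I. ennreal_rpow (f i) q)"
    using assms by (simp add: ennreal_rpow_inverse)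
  show "(SUP i\<in>I. ennreal_rpow (f i) q) \<le> ennreal_rpow (SUP i\<in>I. f i) q"
    using assms by (intro SUP_least ennreal_rpow_mono SUP_upper) auto
qed

lemma measurable_ennreal_rpow[measurable]: "(\<lambda>x. ennreal_rpow x q) \<in> borel_measurable borel"
  unfolding ennreal_rpow_def by measurable

text \<open>Monotone convergence: taking powers commutes with the increasing supremum.\<close>

lemma Lq_norm_le_of_approximation:
  assumes Q: "0 < Q" and inc: "\<And>L x. b L x \<le> b (Suc L) x"
    and meas: "\<And>L :: nat. b L \<in> borel_measurable M"
    and le: "\<And>x. h x * indicator E x \<le> (SUP L. b L x)"
    and int: "\<And>L. (\<integral>\<^sup>+x. ennreal_rpow (b L x) Q \<partial>M) \<le> ennreal_rpow c Q"
  shows "Lq_norm M (ennreal Q) E h \<le> c"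
proof -
  note [measurable] = meas
  have "(\<integral>\<^sup>+x\<in>E. ennreal_rpow (h x) Q \<partial>M) \<le> (\<integral>\<^sup>+x. (SUP L. ennreal_rpow (b L x) Q) \<partial>M)"
  proof (rule nn_integral_mono)
    fix x
    have "ennreal_rpow (h x) Q * indicator E x = ennreal_rpow (h x * indicator E x) Q"
      by (simp add: ennreal_rpow_0 split: split_indicator)
    also have "\<dots> \<le> ennreal_rpow (SUP L. b L x) Q"
      using Q by (intro ennreal_rpow_mono le) auto
    finally show "ennreal_rpow (h x) Q * indicator E x \<le> (SUP L. ennreal_rpow (b L x) Q)"
      using Q by (simp add: ennreal_rpow_SUP)
  qed
  also have "\<dots> = (SUP L. \<integral>\<^sup>+x. ennreal_rpow (b L x) Q \<partial>M)"
    using inc Q by (intro nn_integral_monotone_convergence_SUP)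
      (auto simp: incseq_Suc_iff le_fun_def intro!: ennreal_rpow_mono measurable_compose[OF _ measurable_ennreal_rpow])
  also have "\<dots> \<le> ennreal_rpow c Q" by (intro SUP_least int)
  finally have "ennreal_rpow (\<integral>\<^sup>+x\<in>E. ennreal_rpow (h x) Q \<partial>M) (1 / Q) \<le> ennreal_rpow (ennreal_rpow c Q) (1 / Q)"
    using Q by (intro ennreal_rpow_mono) auto
  then show ?thesis using Q by (simp add: Lq_norm_def ennreal_rpow_inverse)
qed

lemma Lq_norm_infinity_le:
  assumes "(\<lambda>x. h x * indicator E x) \<in> borel_measurable M" "\<And>x. x \<in> E \<Longrightarrow> h x \<le> c"
  shows "Lq_norm M \<infinity> E h \<le> c"
  unfolding Lq_norm_def using assms by (auto intro!: esssup_I split: split_indicator)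

section \<open>Combining the two steps\<close>

text \<open>The right-hand side of the theorem without its constant.\<close>

definition log_ratio_norm :: "real \<Rightarrow> (int \<Rightarrow> complex) \<Rightarrow> ennreal" where
  "log_ratio_norm p F = Lq_norm (count_space UNIV) (ennreal p) UNIV
               (\<lambda>n. ennreal (ln ((1 + cmod (F n)) / (1 - cmod (F n)))))"

lemma mass_nlft_coeff_le:
  assumes p: "1 \<le> p" and F: "\<And>n. cmod (F n) < 1" and x: "0 \<le> x" "log_ratio_norm p F = ennreal x"
  shows "mass p (nlft_coeff F) s t \<le> x powr p"
proof -
  let ?l = "\<lambda>n. ln ((1 + cmod (F n)) / (1 - cmod (F n)))"
  have l: "cmod (nlft_coeff F n) \<le> ?l n" "0 \<le> ?l n" for n
  proof -
    show "0 \<le> ?l n" using F[of n] by (intro ln_ge_zero) (simp add: field_simps)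
    then show "cmod (nlft_coeff F n) \<le> ?l n" using norm_nlft_coeff[where F = F and n = n, OF F] by simp
  qed
  have "ennreal (mass p (nlft_coeff F) s t) = (\<Sum>n\<in>{s+1..t}. ennreal (cmod (nlft_coeff F n) powr p))"
    by (simp add: mass_def)
  also have "\<dots> \<le> (\<Sum>n\<in>{s+1..t}. ennreal_rpow (ennreal (?l n)) p)"
    using p l by (intro sum_mono) (auto simp: ennreal_rpow_ennreal intro!: ennreal_leI powr_mono2)
  also have "\<dots> = (\<integral>\<^sup>+n. ennreal_rpow (ennreal (?l n)) p * indicator {s+1..t} n \<partial>count_space UNIV)"
    by (subst nn_integral_count_space'[of "{s+1..t}"]) (auto split: split_indicator)
  also have "\<dots> \<le> (\<integral>\<^sup>+n. ennreal_rpow (ennreal (?l n)) p \<partial>count_space UNIV)"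
    by (intro nn_integral_mono) (auto split: split_indicator)
  also have "\<dots> = ennreal_rpow (log_ratio_norm p F) p"
    using p by (simp add: log_ratio_norm_def Lq_norm_def ennreal_rpow_inverse)
  also have "\<dots> = ennreal (x powr p)" using x by (simp add: ennreal_rpow_ennreal)
  finally show ?thesis by (simp add: ennreal_le_iff)
qed

lemma variation_within_le_control:
  fixes \<rho> :: real
  assumes \<rho>: "1 \<le> \<rho>" "\<rho> < 2"
  obtains C where "1 \<le> C" and
    "\<And>F z w s t. (\<And>n. cmod (F n) < 1) \<Longrightarrow> cmod z = 1 \<Longrightarrow> control w s t \<Longrightarrow>
      (\<And>M N. s \<le> M \<Longrightarrow> M \<le> N \<Longrightarrow> N \<le> t \<Longrightarrow>
        cmod (trig_sum (nlft_coeff F) M N z) \<le> w M N powr (1 / \<rho>)) \<Longrightarrow>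
      variation_within {s..t} \<rho> F z \<le> ennreal (C * (w s t powr (1 / \<rho>) + w s t))"
proof -
  obtain C where C: "1 \<le> C" and sum_le:
    "\<And>F z w s t K N. (\<And>n. cmod (F n) < 1) \<Longrightarrow> cmod z = 1 \<Longrightarrow> control w s t \<Longrightarrow>
      (\<And>M N. s \<le> M \<Longrightarrow> M \<le> N \<Longrightarrow> N \<le> t \<Longrightarrow>
        cmod (trig_sum (nlft_coeff F) M N z) \<le> w M N powr (1 / \<rho>)) \<Longrightarrow>
      (\<And>j. j < K \<Longrightarrow> N j \<le> N (Suc j)) \<Longrightarrow> s \<le> N 0 \<Longrightarrow> N K \<le> t \<Longrightarrow>
      (\<Sum>j<K. nlft_dist F (N j) (N (Suc j)) z powr \<rho>) powr (1 / \<rho>)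
        \<le> C * (w s t powr (1 / \<rho>) + w s t)"
    using variation_sum_le_control[OF \<rho>] by blast
  show thesis
  proof (rule that[OF C])
    fix F z w s t
    assume *: "\<And>n. cmod (F n) < 1" "cmod z = 1" "control w s t"
      "\<And>M N. s \<le> M \<Longrightarrow> M \<le> N \<Longrightarrow> N \<le> t \<Longrightarrow>
        cmod (trig_sum (nlft_coeff F) M N z) \<le> w M N powr (1 / \<rho>)"
    show "variation_within {s..t} \<rho> F z \<le> ennreal (C * (w s t powr (1 / \<rho>) + w s t))"
      unfolding variation_within_def
    proof (intro SUP_least ennreal_leI)
      fix K :: nat and N :: "nat \<Rightarrow> int"
      assume "N \<in> {N. strict_mono_on {0..K} N \<and> N ` {0..K} \<subseteq> {s..t}}"
      then have N: "strict_mono_on {0..K} N" "N ` {0..K} \<subseteq> {s..t}" by auto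
      then have "N j \<le> N (Suc j)" if "j < K" for j
        using strict_mono_onD[OF N(1), of j "Suc j"] that by auto
      moreover have "s \<le> N 0" "N K \<le> t" using N(2) by (auto simp: image_subset_iff)
      ultimately show "(\<Sum>j<K. nlft_dist F (N j) (N (Suc j)) z powr \<rho>) powr (1 / \<rho>)
        \<le> C * (w s t powr (1 / \<rho>) + w s t)"
        using * by (intro sum_le) auto
    qed
  qed
qed

text \<open>If \<open>v \<le> 1\<close> then \<open>V\<rho> \<le> 2 * C * v\<close>, and \<open>V\<rho> > 1\<close> forces \<open>2 * C * v > 1\<close>, so that passing to
the \<open>r\<close>-th power only increases it. If \<open>v > 1\<close> then the first claim holds because
\<open>Vr \<le> 1\<close>, and in the second one \<open>v\<close> and \<open>v powr \<rho>\<close> are both at most \<open>v powr r\<close>.\<close>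

lemma variation_dichotomy:
  fixes v C \<rho> r :: real
  assumes "0 \<le> v" "1 \<le> C" "1 \<le> \<rho>" "\<rho> \<le> r"
    and V: "V\<rho> \<le> ennreal (C * (v + v powr \<rho>))" and Vr: "Vr \<le> V\<rho>"
  shows "V\<rho> \<le> 1 \<Longrightarrow> Vr \<le> ennreal (2 * C * v)"
    and "\<not> V\<rho> \<le> 1 \<Longrightarrow> Vr \<le> ennreal ((2 * C * v) powr r)"
proof -
  have C1: "x \<le> C * x" if "0 \<le> x" for x using assms(2) that mult_right_mono[of 1 C x] by simp
  have small: "V\<rho> \<le> ennreal (2 * C * v)" if "v \<le> 1"
  proof -
    have "v powr \<rho> \<le> v" using powr_mono'[of 1 \<rho> v] that assms by simp
    then have "C * (v + v powr \<rho>) \<le> C * (2 * v)" using assms by (intro mult_left_mono) auto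
    then show ?thesis by (intro order_trans[OF V] ennreal_leI) simp
  qed
  show "Vr \<le> ennreal (2 * C * v)" if "V\<rho> \<le> 1"
  proof (cases "v \<le> 1")
    case True
    then show ?thesis using Vr small by auto
  next
    case False
    then have "1 \<le> 2 * C * v" using C1[of v] by linarith
    then have "ennreal 1 \<le> ennreal (2 * C * v)" by (rule ennreal_leI)
    then have "V\<rho> \<le> ennreal (2 * C * v)" using that by (simp add: order_trans)
    with Vr show ?thesis by (rule order_trans)
  qed
  show "Vr \<le> ennreal ((2 * C * v) powr r)" if "\<not> V\<rho> \<le> 1"
  proof (cases "v \<le> 1")
    case True
    have "1 \<le> 2 * C * v"
    proof (rule ccontr)
      assume "\<not> 1 \<le> 2 * C * v"
      then have "ennreal (2 * C * v) \<le> ennreal 1" by (intro ennreal_leI) auto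
      with small[OF True] have "V\<rho> \<le> ennreal 1" by (rule order_trans)
      then show False using that by simp
    qed
    then have "2 * C * v \<le> (2 * C * v) powr r" using powr_mono[of 1 r "2 * C * v"] assms by simp
    then show ?thesis using Vr small[OF True] by (meson ennreal_leI order_trans)
  next
    case False
    then have v: "v > 1" by simp
    have "v \<le> v powr r" using powr_mono[of 1 r v] v assms by simp
    moreover have "v powr \<rho> \<le> v powr r" using v assms by (intro powr_mono) auto
    ultimately have "C * (v + v powr \<rho>) \<le> C * (2 * v powr r)" using assms by (intro mult_left_mono) auto
    also have "\<dots> = (2 * C) * v powr r" by simp
    also have "\<dots> \<le> (2 * C) powr r * v powr r"
      using powr_mono[of 1 r "2 * C"] assms by (intro mult_right_mono) auto
    also have "\<dots> = (2 * C * v) powr r" using assms by (simp add: powr_mult)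
    finally have "ennreal (C * (v + v powr \<rho>)) \<le> ennreal ((2 * C * v) powr r)" by (rule ennreal_leI)
    with V have "V\<rho> \<le> ennreal ((2 * C * v) powr r)" by (rule order_trans)
    with Vr show ?thesis by (rule order_trans)
  qed
qed

lemma threshold_exponent_bounds:
  assumes "1 \<le> p" "p < 2" "p < r"
  shows "p < threshold_exponent p r" "threshold_exponent p r < 2" "threshold_exponent p r \<le> r"
  using assms by (auto simp: threshold_exponent_def)

text \<open>The variation within a window is at most the full one, so on the set of small variation the
first alternative of \<open>variation_dichotomy\<close> is available in every window.\<close>

lemma window_bounds:
  fixes p r \<rho> C v :: real and F :: "int \<Rightarrow> complex" and L :: nat
  defines "\<rho> \<equiv> threshold_exponent p r"
  defines "W \<equiv> \<lambda>e. variation_within {- int L..int L} e F"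
  assumes p: "1 \<le> p" "p < 2" "p < r" and "0 \<le> v" "1 \<le> C"
    and V: "W \<rho> z \<le> ennreal (C * (v + v powr \<rho>))"
  shows "z \<in> small_variation_set p r F \<Longrightarrow> W r z \<le> ennreal (2 * C * v)"
    and "\<not> W \<rho> z \<le> 1 \<Longrightarrow> W r z \<le> ennreal ((2 * C * v) powr r)"
proof -
  note \<rho> = threshold_exponent_bounds[OF p, folded \<rho>_def]
  have W: "W r z \<le> W \<rho> z" unfolding W_def using \<rho> p by (intro variation_within_antimono_exponent) auto
  have "1 \<le> \<rho>" using \<rho> p by auto
  note dich = variation_dichotomy[OF \<open>0 \<le> v\<close> \<open>1 \<le> C\<close> this \<rho>(3) V W]
  show "W r z \<le> ennreal (2 * C * v)" if "z \<in> small_variation_set p r F"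
  proof (rule dich(1))
    have "W \<rho> z \<le> nlft_variation \<rho> F z"
      unfolding W_def nlft_variation_eq_within by (intro variation_within_mono) auto
    then show "W \<rho> z \<le> 1" using that by (auto simp: small_variation_set_def \<rho>_def)
  qed
  show "W r z \<le> ennreal ((2 * C * v) powr r)" if "\<not> W \<rho> z \<le> 1" using dich(2)[OF that] .
qed

text \<open>Off the set of small variation the \<open>\<rho>\<close>-variation exceeds \<open>1\<close> already within some window, hence within all
larger ones. The smaller windows may be replaced by zero without changing the supremum.\<close>

lemma large_variation_le_SUP:
  fixes F p r
  defines "\<rho> \<equiv> threshold_exponent p r"
  defines "W \<equiv> \<lambda>L::nat. \<lambda>e. variation_within {- int L..int L} e F"
  assumes z: "z \<in> unit_circle - small_variation_set p r F"
  shows "nlft_variation r F z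
    \<le> (SUP L. W L r z * indicator {z \<in> unit_circle. \<not> W L \<rho> z \<le> 1} z)" (is "_ \<le> (SUP L. ?b L)")
proof -
  have "1 < nlft_variation \<rho> F z" using z by (auto simp: small_variation_set_def \<rho>_def)
  then obtain L0 where L0: "1 < W L0 \<rho> z" by (auto simp: nlft_variation_eq_SUP less_SUP_iff W_def)
  have mono: "W L e z \<le> W L' e z" if "L \<le> L'" for L L' e
    unfolding W_def using that by (intro variation_within_mono) auto
  show ?thesis
    unfolding nlft_variation_eq_SUP[of r]
  proof (rule SUP_least)
    fix L
    have "\<not> W (max L L0) \<rho> z \<le> 1" using L0 mono[of L0 "max L L0" \<rho>] by auto
    then have "W L r z \<le> ?b (max L L0)" using z mono[of L "max L L0" r] by simp
    also have "\<dots> \<le> (SUP L. ?b L)" by (rule SUP_upper) simp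
    finally show "variation_within {- int L..int L} r F z \<le> (SUP L. ?b L)" by (simp add: W_def)
  qed
qed

text \<open>On each window \<open>u = 2 * C * v\<close> dominates the variation where it is small, and \<open>u powr r\<close> dominates
it elsewhere; both norms therefore come down to the integral of \<open>u powr q\<close>, which is the integral of
\<open>w powr (q/\<rho>)\<close> up to a constant.\<close>

lemma nlft_bound_exponent_gt_1:
  fixes p r q :: real
  assumes p: "1 < p" "p < 2" "p < r" and q: "q = p / (p - 1)"
  obtains D where "0 \<le> D" and
    "\<And>F x. (\<And>n. cmod (F n) < 1) \<Longrightarrow> 0 \<le> x \<Longrightarrow> log_ratio_norm p F = ennreal x \<Longrightarrow>
       Lq_norm circle_measure (ennreal q) (small_variation_set p r F) (nlft_variation r F) \<le> ennreal (D * x) \<and>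
       Lq_norm circle_measure (ennreal (q / r)) (unit_circle - small_variation_set p r F) (nlft_variation r F)
         \<le> ennreal ((D * x) powr r)"
proof -
  define \<rho> where "\<rho> = threshold_exponent p r"
  have \<rho>: "p < \<rho>" "\<rho> < 2" "\<rho> \<le> r" "1 \<le> \<rho>"
    using threshold_exponent_bounds[of p r] p by (auto simp: \<rho>_def)
  have q2: "q > 2" using p by (auto simp: q field_simps)
  obtain B where B: "0 \<le> B" and tree: "\<And>f s t. s \<le> t \<Longrightarrow> \<exists>w. tree_control \<rho> f s t w \<and>
      (\<integral>\<^sup>+z. ennreal (w z s t powr (q / \<rho>)) \<partial>circle_measure) \<le> ennreal (B * mass p f s t powr (q / p))"
    using tree_control_exists[OF p(1) \<rho>(1,2) q] by blast
  obtain C where C: "1 \<le> C" and var: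
    "\<And>F z w s t. (\<And>n. cmod (F n) < 1) \<Longrightarrow> cmod z = 1 \<Longrightarrow> control w s t \<Longrightarrow>
      (\<And>M N. s \<le> M \<Longrightarrow> M \<le> N \<Longrightarrow> N \<le> t \<Longrightarrow>
        cmod (trig_sum (nlft_coeff F) M N z) \<le> w M N powr (1 / \<rho>)) \<Longrightarrow>
      variation_within {s..t} \<rho> F z \<le> ennreal (C * (w s t powr (1 / \<rho>) + w s t))"
    using variation_within_le_control[OF \<rho>(4,2)] by blast
  define k where "k = (2 * C * 3) powr q"
  define D where "D = (k * B) powr (1 / q)"
  have k: "0 \<le> k" by (simp add: k_def)
  show thesis
  proof (rule that[of D])
    show "0 \<le> D" by (simp add: D_def)
    fix F :: "int \<Rightarrow> complex" and x :: real
    assume F: "\<And>n. cmod (F n) < 1" and x: "0 \<le> x" "log_ratio_norm p F = ennreal x"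
    define W where "W = (\<lambda>L::nat. \<lambda>e. variation_within {- int L..int L} e F)"
    let ?S = "small_variation_set p r F"
    have [measurable]: "W L e \<in> borel_measurable borel" for L e by (simp add: W_def)
    have [measurable_cong]: "sets circle_measure = sets borel" by (simp add: circle_measure_def)
    have uc[measurable]: "unit_circle \<in> sets borel" by (simp add: unit_circle_def)
    define a where "a L z = W L r z * indicator ?S z" for L z
    define b where "b L z = W L r z * indicator {z \<in> unit_circle. \<not> W L \<rho> z \<le> 1} z" for L z
    have Wmono: "W L e z \<le> W (Suc L) e z" for L e z
      unfolding W_def by (intro variation_within_mono) auto
    have amono: "a L z \<le> a (Suc L) z" for L z
      unfolding a_def by (intro mult_right_mono Wmono) auto
    have bmono: "b L z \<le> b (Suc L) z" for L z
      using Wmono[of L r z] order_trans[OF Wmono[of L \<rho> z], of 1]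
      unfolding b_def by (auto split: split_indicator)
    have [measurable]: "a L \<in> borel_measurable circle_measure" "b L \<in> borel_measurable circle_measure" for L
      unfolding a_def[abs_def] b_def[abs_def] by measurable
    have ex: "\<exists>u. (\<forall>z. cmod z = 1 \<longrightarrow> a L z \<le> ennreal (u z) \<and> b L z \<le> ennreal (u z powr r)) \<and>
        (\<forall>z. 0 \<le> u z) \<and> (\<integral>\<^sup>+z. ennreal (u z powr q) \<partial>circle_measure) \<le> ennreal ((D * x) powr q)" for L
    proof -
      obtain w where w: "tree_control \<rho> (nlft_coeff F) (- int L) (int L) w"
        "(\<integral>\<^sup>+z. ennreal (w z (- int L) (int L) powr (q / \<rho>)) \<partial>circle_measure)
          \<le> ennreal (B * mass p (nlft_coeff F) (- int L) (int L) powr (q / p))"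
        using tree[of "- int L" "int L"] by auto
      define w0 where "w0 z = w z (- int L) (int L)" for z
      have w0: "0 \<le> w0 z" for z
        using w(1) unfolding tree_control_def w0_def by (auto intro: control_nonneg[of "w z" "- int L" "int L"])
      have [measurable]: "w0 \<in> borel_measurable borel"
        using w(1) unfolding tree_control_def w0_def[abs_def] by auto
      define v where "v z = (3 powr \<rho> * w0 z) powr (1 / \<rho>)" for z
      have v: "0 \<le> v z" "v z powr \<rho> = 3 powr \<rho> * w0 z" for z
        using \<rho> w0[of z] by (auto simp: v_def powr_powr)
      define u where "u z = 2 * C * v z" for z
      have var_le: "W L \<rho> z \<le> ennreal (C * (v z + v z powr \<rho>))" if z: "cmod z = 1" for z
      proof -
        have "control (\<lambda>M N. 3 powr \<rho> * w z M N) (- int L) (int L)"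
          using w(1) unfolding tree_control_def by (intro control_scale) auto
        moreover have "cmod (trig_sum (nlft_coeff F) M N z) \<le> (3 powr \<rho> * w z M N) powr (1 / \<rho>)"
          if "- int L \<le> M" "M \<le> N" "N \<le> int L" for M N
        proof -
          have "cmod (trig_sum (nlft_coeff F) M N z) powr \<rho> \<le> 3 powr \<rho> * w z M N"
            using w(1) z that unfolding tree_control_def by blast
          then have "(cmod (trig_sum (nlft_coeff F) M N z) powr \<rho>) powr (1 / \<rho>)
            \<le> (3 powr \<rho> * w z M N) powr (1 / \<rho>)"
            using \<rho> by (intro powr_mono2) auto
          then show ?thesis using \<rho> by (simp add: powr_powr)
        qed
        ultimately show ?thesis
          using var[OF F z, of "\<lambda>M N. 3 powr \<rho> * w z M N" "- int L" "int L"] v(2)[of z]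
          by (simp add: W_def v_def w0_def)
      qed
      have "a L z \<le> ennreal (u z) \<and> b L z \<le> ennreal (u z powr r)" if "cmod z = 1" for z
        using window_bounds[of p r "v z" C L F z] p v(1)[of z] C var_le[OF that]
        by (auto simp: a_def b_def u_def W_def \<rho>_def split: split_indicator)
      moreover have "0 \<le> u z" for z using C v by (simp add: u_def)
      moreover have "(\<integral>\<^sup>+z. ennreal (u z powr q) \<partial>circle_measure) \<le> ennreal ((D * x) powr q)"
      proof -
        have "u z powr q = k * w0 z powr (q / \<rho>)" for z
          using C \<rho> w0[of z] by (simp add: u_def v_def k_def powr_mult powr_powr)
        then have "(\<integral>\<^sup>+z. ennreal (u z powr q) \<partial>circle_measure)
            = ennreal k * (\<integral>\<^sup>+z. ennreal (w0 z powr (q / \<rho>)) \<partial>circle_measure)"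
          using k by (simp add: ennreal_mult nn_integral_cmult)
        also have "\<dots> \<le> ennreal k * ennreal (B * mass p (nlft_coeff F) (- int L) (int L) powr (q / p))"
          using w(2) by (intro mult_left_mono) (auto simp: w0_def)
        also have "\<dots> \<le> ennreal k * ennreal (B * (x powr p) powr (q / p))"
          using B p q2 mass_nlft_coeff_le[OF _ F x, of "- int L" "int L"]
          by (intro mult_left_mono ennreal_leI powr_mono2 mass_nonneg) auto
        also have "\<dots> = ennreal (k * B * x powr q)"
          using k B p by (simp add: powr_powr mult.assoc flip: ennreal_mult)
        also have "k * B * x powr q = (D * x) powr q"
          using k B x q2 by (simp add: D_def powr_mult powr_powr)
        finally show ?thesis .
      qed
      ultimately show ?thesis by blast
    qed
    have Dx: "0 \<le> D * x" using x by (simp add: D_def)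
    have "Lq_norm circle_measure (ennreal q) ?S (nlft_variation r F) \<le> ennreal (D * x)"
    proof (rule Lq_norm_le_of_approximation[where b = a])
      show "nlft_variation r F z * indicator ?S z \<le> (SUP L. a L z)" for z
        by (simp add: nlft_variation_eq_SUP SUP_mult_right_ennreal a_def W_def)
      fix L
      obtain u where u: "\<And>z. cmod z = 1 \<Longrightarrow> a L z \<le> ennreal (u z)" "\<And>z. 0 \<le> u z"
        "(\<integral>\<^sup>+z. ennreal (u z powr q) \<partial>circle_measure) \<le> ennreal ((D * x) powr q)"
        using ex[of L] by blast
      have "(\<integral>\<^sup>+z. ennreal_rpow (a L z) q \<partial>circle_measure) \<le> (\<integral>\<^sup>+z. ennreal (u z powr q) \<partial>circle_measure)"
      proof (rule nn_integral_mono_AE, use AE_circle in eventually_elim)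
        case (elim z)
        have "ennreal_rpow (a L z) q \<le> ennreal_rpow (ennreal (u z)) q"
          using q2 u(1)[OF elim] by (intro ennreal_rpow_mono) auto
        then show ?case using u(2) by (simp add: ennreal_rpow_ennreal)
      qed
      then show "(\<integral>\<^sup>+z. ennreal_rpow (a L z) q \<partial>circle_measure) \<le> ennreal_rpow (ennreal (D * x)) q"
        using u(3) Dx by (simp add: ennreal_rpow_ennreal)
    qed (use q2 amono in auto)
    moreover have "Lq_norm circle_measure (ennreal (q / r)) (unit_circle - ?S) (nlft_variation r F)
         \<le> ennreal ((D * x) powr r)"
    proof (rule Lq_norm_le_of_approximation[where b = b])
      show "nlft_variation r F z * indicator (unit_circle - ?S) z \<le> (SUP L. b L z)" for z
        using large_variation_le_SUP[of z p r F] by (auto simp: b_def W_def \<rho>_def split: split_indicator)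
      fix L
      obtain u where u: "\<And>z. cmod z = 1 \<Longrightarrow> b L z \<le> ennreal (u z powr r)" "\<And>z. 0 \<le> u z"
        "(\<integral>\<^sup>+z. ennreal (u z powr q) \<partial>circle_measure) \<le> ennreal ((D * x) powr q)"
        using ex[of L] by blast
      have "(\<integral>\<^sup>+z. ennreal_rpow (b L z) (q / r) \<partial>circle_measure) \<le> (\<integral>\<^sup>+z. ennreal (u z powr q) \<partial>circle_measure)"
      proof (rule nn_integral_mono_AE, use AE_circle in eventually_elim)
        case (elim z)
        have "ennreal_rpow (b L z) (q / r) \<le> ennreal_rpow (ennreal (u z powr r)) (q / r)"
          using q2 p u(1)[OF elim] by (intro ennreal_rpow_mono) auto
        then show ?case using u(2) p by (simp add: ennreal_rpow_ennreal powr_powr)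
      qed
      then show "(\<integral>\<^sup>+z. ennreal_rpow (b L z) (q / r) \<partial>circle_measure)
          \<le> ennreal_rpow (ennreal ((D * x) powr r)) (q / r)"
        using u(3) Dx p by (simp add: ennreal_rpow_ennreal powr_powr)
    qed (use q2 p bmono in auto)
    ultimately show "Lq_norm circle_measure (ennreal q) ?S (nlft_variation r F) \<le> ennreal (D * x) \<and>
       Lq_norm circle_measure (ennreal (q / r)) (unit_circle - ?S) (nlft_variation r F)
         \<le> ennreal ((D * x) powr r)" by blast
  qed
qed

text \<open>The \<open>\<ell>\<^sup>1\<close>-mass of an interval bounds the linear sum for every \<open>z\<close>, and its
\<open>\<rho>\<close>-th power is a control, so the pointwise estimates are uniform on the circle.\<close>

lemma nlft_bound_exponent_1:
  fixes r :: real
  assumes r: "1 < r"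
  obtains D where "0 \<le> D" and
    "\<And>F x. (\<And>n. cmod (F n) < 1) \<Longrightarrow> 0 \<le> x \<Longrightarrow> log_ratio_norm 1 F = ennreal x \<Longrightarrow>
       Lq_norm circle_measure \<infinity> (small_variation_set 1 r F) (nlft_variation r F) \<le> ennreal (D * x) \<and>
       Lq_norm circle_measure \<infinity> (unit_circle - small_variation_set 1 r F) (nlft_variation r F)
         \<le> ennreal ((D * x) powr r)"
proof -
  define \<rho> where "\<rho> = threshold_exponent 1 r"
  have \<rho>: "1 < \<rho>" "\<rho> < 2" "\<rho> \<le> r" "1 \<le> \<rho>"
    using threshold_exponent_bounds[of 1 r] r by (auto simp: \<rho>_def)
  obtain C where C: "1 \<le> C" and var:
    "\<And>F z w s t. (\<And>n. cmod (F n) < 1) \<Longrightarrow> cmod z = 1 \<Longrightarrow> control w s t \<Longrightarrow>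
      (\<And>M N. s \<le> M \<Longrightarrow> M \<le> N \<Longrightarrow> N \<le> t \<Longrightarrow>
        cmod (trig_sum (nlft_coeff F) M N z) \<le> w M N powr (1 / \<rho>)) \<Longrightarrow>
      variation_within {s..t} \<rho> F z \<le> ennreal (C * (w s t powr (1 / \<rho>) + w s t))"
    using variation_within_le_control[OF \<rho>(4,2)] by blast
  show thesis
  proof (rule that[of "2 * C"])
    show "0 \<le> 2 * C" using C by simp
    fix F :: "int \<Rightarrow> complex" and x :: real
    assume F: "\<And>n. cmod (F n) < 1" and x: "0 \<le> x" "log_ratio_norm 1 F = ennreal x"
    define W where "W = (\<lambda>L::nat. \<lambda>e. variation_within {- int L..int L} e F)"
    let ?S = "small_variation_set 1 r F"
    have [measurable_cong]: "sets circle_measure = sets borel" by (simp add: circle_measure_def)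
    have [measurable]: "unit_circle \<in> sets borel" by (simp add: unit_circle_def)
    have var_le: "W L \<rho> z \<le> ennreal (C * (x + x powr \<rho>))" if z: "cmod z = 1" for L z
    proof -
      define m where "m = mass 1 (nlft_coeff F)"
      have m: "0 \<le> m M N" "m M N \<le> x" for M N
        using mass_nlft_coeff_le[OF _ F x, of M N] x by (auto simp: m_def mass_nonneg)
      have "cmod (trig_sum (nlft_coeff F) M N z) \<le> m M N" for M N
        unfolding trig_sum_def m_def mass_def
        by (rule order_trans[OF norm_sum]) (simp add: norm_mult norm_power_int_unit z)
      then have "W L \<rho> z \<le> ennreal (C * ((m (- int L) (int L) powr \<rho>) powr (1 / \<rho>) + m (- int L) (int L) powr \<rho>))"
        unfolding W_def using \<rho> m
        by (intro var[OF F z] control_powr) (auto simp: m_def control_mass powr_powr)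
      also have "\<dots> \<le> ennreal (C * (x + x powr \<rho>))"
        using m[of "- int L" "int L"] C \<rho> by (intro ennreal_leI mult_left_mono add_mono powr_mono2) (auto simp: powr_powr)
      finally show ?thesis .
    qed
    have "nlft_variation r F z \<le> ennreal (2 * C * x)" if "z \<in> ?S" for z
      unfolding nlft_variation_eq_SUP
    proof (rule SUP_least)
      fix L
      have "cmod z = 1" using that by (auto simp: small_variation_set_def unit_circle_def)
      then show "variation_within {- int L..int L} r F z \<le> ennreal (2 * C * x)"
        using window_bounds(1)[of 1 r x C L F z] r x C that var_le[of z L] by (simp add: W_def \<rho>_def)
    qed
    moreover have "nlft_variation r F z \<le> ennreal ((2 * C * x) powr r)" if z: "z \<in> unit_circle - ?S" for z
    proof (rule order_trans[OF large_variation_le_SUP[OF z]], rule SUP_least)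
      fix L
      have "cmod z = 1" using z by (auto simp: unit_circle_def)
      then show "variation_within {- int L..int L} r F z *
          indicator {z \<in> unit_circle. \<not> variation_within {- int L..int L} (threshold_exponent 1 r) F z \<le> 1} z
          \<le> ennreal ((2 * C * x) powr r)"
        using window_bounds(2)[of 1 r x C L F z] r x C var_le[of z L]
        by (auto simp: W_def \<rho>_def split: split_indicator)
    qed
    ultimately show "Lq_norm circle_measure \<infinity> ?S (nlft_variation r F) \<le> ennreal (2 * C * x) \<and>
       Lq_norm circle_measure \<infinity> (unit_circle - ?S) (nlft_variation r F) \<le> ennreal ((2 * C * x) powr r)"
      by (intro conjI Lq_norm_infinity_le) measurable
  qed
qed

theorem theorem1p1:
  fixes p r :: real
  assumes "1 \<le> p" "p < 2" "p < r"
  shows "\<exists>C::ennreal. C < \<infinity> \<and>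
    (\<forall>F \<in> ellp_disc p.
       Lq_norm circle_measure (conj_exponent p) (small_variation_set p r F) (nlft_variation r F)
       + ennreal_rpow
           (Lq_norm circle_measure (conj_exponent p / ennreal r)
              (unit_circle - small_variation_set p r F) (nlft_variation r F))
           (1 / r)
       \<le> C * Lq_norm (count_space UNIV) (ennreal p) UNIV
               (\<lambda>n. ennreal (ln ((1 + cmod (F n)) / (1 - cmod (F n))))))"
proof -
  have r: "0 < r" using assms by auto
  obtain D where D: "0 \<le> D" and bound:
    "\<And>F x. (\<And>n. cmod (F n) < 1) \<Longrightarrow> 0 \<le> x \<Longrightarrow> log_ratio_norm p F = ennreal x \<Longrightarrow>
       Lq_norm circle_measure (conj_exponent p) (small_variation_set p r F) (nlft_variation r F) \<le> ennreal (D * x) \<and>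
       Lq_norm circle_measure (conj_exponent p / ennreal r) (unit_circle - small_variation_set p r F) (nlft_variation r F)
         \<le> ennreal ((D * x) powr r)"
  proof (cases "p = 1")
    case True
    show thesis
    proof (rule nlft_bound_exponent_1[of r])
      show "1 < r" using assms True by simp
      fix D assume "0 \<le> D" and D: "\<And>F x. (\<And>n. cmod (F n) < 1) \<Longrightarrow> 0 \<le> x \<Longrightarrow> log_ratio_norm 1 F = ennreal x \<Longrightarrow>
       Lq_norm circle_measure \<infinity> (small_variation_set 1 r F) (nlft_variation r F) \<le> ennreal (D * x) \<and>
       Lq_norm circle_measure \<infinity> (unit_circle - small_variation_set 1 r F) (nlft_variation r F)
         \<le> ennreal ((D * x) powr r)"
      show thesis
        by (rule that[OF \<open>0 \<le> D\<close>])
          (use D in \<open>simp add: True conj_exponent_def ennreal_top_divide\<close>)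
    qed
  next
    case False
    then have p: "1 < p" using assms by simp
    define q where "q = p / (p - 1)"
    have "0 \<le> q" using p by (simp add: q_def)
    then have eq: "conj_exponent p = ennreal q" "ennreal q / ennreal r = ennreal (q / r)"
      using False r by (simp_all add: conj_exponent_def divide_ennreal q_def)
    show thesis
      by (rule nlft_bound_exponent_gt_1[OF p assms(2,3) q_def], rule that) (assumption, unfold eq, blast)
  qed
  show ?thesis
  \<comment> \<open>Each norm costs \<open>D\<close>; a positive constant keeps the right-hand side infinite if the norm of the data is.\<close>
  proof (intro exI[of _ "ennreal (2 * D + 1)"] conjI ballI)
    show "ennreal (2 * D + 1) < \<infinity>" by simp
    fix F assume "F \<in> ellp_disc p"
    then have F: "cmod (F n) < 1" for n by (auto simp: ellp_disc_def)
    let ?A = "Lq_norm circle_measure (conj_exponent p) (small_variation_set p r F) (nlft_variation r F)"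
    let ?B = "Lq_norm circle_measure (conj_exponent p / ennreal r) (unit_circle - small_variation_set p r F) (nlft_variation r F)"
    have "?A + ennreal_rpow ?B (1 / r) \<le> ennreal (2 * D + 1) * log_ratio_norm p F"
    proof (cases "log_ratio_norm p F")
      case top
      then show ?thesis using D by (simp add: ennreal_mult_top)
    next
      case (real x)
      have "ennreal_rpow ?B (1 / r) \<le> ennreal_rpow (ennreal ((D * x) powr r)) (1 / r)"
        using bound[OF F real] r by (intro ennreal_rpow_mono) auto
      also have "\<dots> = ennreal (D * x)"
        using r D real by (simp add: ennreal_rpow_ennreal powr_powr)
      finally have "?A + ennreal_rpow ?B (1 / r) \<le> ennreal (D * x) + ennreal (D * x)"
        using bound[OF F real] by (intro add_mono) auto
      also have "\<dots> \<le> ennreal ((2 * D + 1) * x)"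
        using D real by (subst ennreal_plus[symmetric]) (auto intro!: ennreal_leI simp: algebra_simps)
      also have "\<dots> = ennreal (2 * D + 1) * log_ratio_norm p F" using D real by (simp add: ennreal_mult)
      finally show ?thesis .
    qed
    then show "?A + ennreal_rpow ?B (1 / r) \<le> ennreal (2 * D + 1) * Lq_norm (count_space UNIV) (ennreal p) UNIV
               (\<lambda>n. ennreal (ln ((1 + cmod (F n)) / (1 - cmod (F n)))))"
      by (simp add: log_ratio_norm_def)
  qed
qed

end
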